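(* Let $G_n$ be a full Steiner topology on $n$ terminals. There exists a set $N$ of $n$ embedded terminals in the Euclidean plane, with a Euclidean Steiner minimal tree $T_S$ on $N$ and a Euclidean minimum Steiner point tree $T_{\mathrm{opt}}$ on $N$, such that $T_S$ has topology $G_n$ and $$\mathrm{beads}(T_S)=\mathrm{beads}(T_{\mathrm{opt}})+2n-4 .$$
   Context: All lengths are Euclidean, and $|e|$ is the length of an edge $e$. A tree interconnecting a finite terminal set $N$ is an embedded tree with node set $N\cup W$, where $W$ is a finite set of additional nodes (Steiner points), each of degree at least three. A Steiner minimal tree (SMT) on $N$ is a tree interconnecting $N$ of minimum total edge length. A full Steiner topology on $n$ terminals is an abstract (non-embedded) tree with $n$ terminals, each of degree one, and $n-2$ Steiner points, each of degree three. For a tree $T$ interconnecting $N$ with $|N|=n\ge2$, $T^*$ denotes the tree obtained by splitting nodes of $T$ until every terminal has degree one and every Steiner point has degree three. To split a node $v$ means to disconnect two or more edges at $v$, connect them instead to a new Steiner point, and join this new point to $v$ by an extra edge. New nodes keep their original position, so the extra edges have length zero. $T^*$ has $m=2n-3$ edges $e_1,\dots,e_m$. The bead count is $\mathrm{beads}(T)=1-n+\sum_{i=1}^m\lceil|e_i|\rceil$. A minimum Steiner point tree (MSPT) on $N$ is a tree interconnecting $N$ that minimizes $\mathrm{beads}$ over all trees interconnecting $N$. *)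

theory Defs
  imports "HOL-Analysis.Analysis"
begin

section \<open>Finite simple graphs and trees\<close>

record 'a ugraph =
  nodes :: "'a set"
  edges :: "'a set set"

definition simple_graph :: "'a ugraph \<Rightarrow> bool" where
  "simple_graph T \<longleftrightarrow> finite (nodes T) \<and>
     (\<forall>e\<in>edges T. \<exists>u\<in>nodes T. \<exists>v\<in>nodes T. u \<noteq> v \<and> e = {u, v})"

definition node_degree :: "'a ugraph \<Rightarrow> 'a \<Rightarrow> nat" where
  "node_degree T v = card {e \<in> edges T. v \<in> e}"

definition connected_graph :: "'a ugraph \<Rightarrow> bool" where
  "connected_graph T \<longleftrightarrow> nodes T \<noteq> {} \<and>
     (\<forall>u\<in>nodes T. \<forall>v\<in>nodes T. (u, v) \<in> {(x, y). {x, y} \<in> edges T}\<^sup>*)"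

definition is_cycle :: "'a ugraph \<Rightarrow> 'a list \<Rightarrow> bool" where
  "is_cycle T p \<longleftrightarrow> 3 \<le> length p \<and> distinct p \<and>
     (\<forall>i < length p. {p ! i, p ! (Suc i mod length p)} \<in> edges T)"

definition tree :: "'a ugraph \<Rightarrow> bool" where
  "tree T \<longleftrightarrow> simple_graph T \<and> connected_graph T \<and> \<not> (\<exists>p. is_cycle T p)"

text \<open>
  \<open>full_steiner_topology n X G\<close>: \<open>G\<close> is a full Steiner topology on \<open>n\<close> terminals, \<open>X\<close> being
  its set of terminals.  The number \<open>n - 2\<close> of Steiner points is required to be the true
  (not the truncated) difference, so \<open>n \<ge> 2\<close>.
\<close>

definition full_steiner_topology :: "nat \<Rightarrow> 'a set \<Rightarrow> 'a ugraph \<Rightarrow> bool" where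
  "full_steiner_topology n X G \<longleftrightarrow> tree G \<and> X \<subseteq> nodes G \<and>
     card X = n \<and> card (nodes G - X) + 2 = n \<and>
     (\<forall>x\<in>X. node_degree G x = 1) \<and> (\<forall>s\<in>nodes G - X. node_degree G s = 3)"


section \<open>Trees in the Euclidean plane\<close>

text \<open>
  The nodes of an embedded tree are points of the plane and its edges are straight line
  segments, given by their two endpoints.  An edge \<open>e = {u, v}\<close> thus has length
  \<open>diameter e = dist u v\<close>.  As usual for Steiner trees, edges are not required to be
  non-crossing.
\<close>

type_synonym point = "real ^ 2"

lemma diameter_doubleton: "diameter {u, v} = dist u (v :: point)"
proof (rule antisym)
  show "diameter {u, v} \<le> dist u v"
    by (rule diameter_le) (auto simp: dist_norm norm_minus_commute)
  show "dist u v \<le> diameter {u, v}"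
    by (rule diameter_bounded_bound) auto
qed

definition interconnects :: "point ugraph \<Rightarrow> point set \<Rightarrow> bool" where
  "interconnects T N \<longleftrightarrow> tree T \<and> N \<subseteq> nodes T \<and> (\<forall>w\<in>nodes T - N. 3 \<le> node_degree T w)"

definition total_length :: "point ugraph \<Rightarrow> real" where
  "total_length T = (\<Sum>e\<in>edges T. diameter e)"

definition steiner_minimal_tree :: "point set \<Rightarrow> point ugraph \<Rightarrow> bool" where
  "steiner_minimal_tree N T \<longleftrightarrow> interconnects T N \<and>
     (\<forall>T'. interconnects T' N \<longrightarrow> total_length T \<le> total_length T')"

text \<open>
  A tree \<open>T\<close> interconnecting \<open>N\<close> has topology \<open>G\<close> if it is isomorphic to \<open>G\<close> by an isomorphism
  that maps the terminals \<open>X\<close> of \<open>G\<close> to the terminals \<open>N\<close> of \<open>T\<close>.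
\<close>

definition has_topology :: "point set \<Rightarrow> point ugraph \<Rightarrow> 'a set \<Rightarrow> 'a ugraph \<Rightarrow> bool" where
  "has_topology N T X G \<longleftrightarrow>
     (\<exists>f. bij_betw f (nodes G) (nodes T) \<and> f ` X = N \<and> edges T = (\<lambda>e. f ` e) ` edges G)"


section \<open>Splitting nodes, and the bead count\<close>

text \<open>
  Splitting produces distinct nodes at the same position.  In a split tree a node is therefore a
  pair \<open>(p, i)\<close> of its position \<open>p\<close> and a tag \<open>i\<close>; the nodes of the original tree carry tag \<open>0\<close>.
\<close>

definition tagged :: "point ugraph \<Rightarrow> (point \<times> nat) ugraph" where
  "tagged T = \<lparr>nodes = (\<lambda>p. (p, 0)) ` nodes T, edges = (\<lambda>e. (\<lambda>p. (p, 0)) ` e) ` edges T\<rparr>"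

text \<open>
  One split of the node \<open>v = (p, i)\<close>: the edges from \<open>v\<close> to the nodes in \<open>U\<close> are connected
  to the new node \<open>s = (p, j)\<close> instead, and \<open>s\<close> is joined to \<open>v\<close>.
\<close>

definition split_step :: "(point \<times> nat) ugraph \<Rightarrow> (point \<times> nat) ugraph \<Rightarrow> bool" where
  "split_step T T' \<longleftrightarrow>
     (\<exists>p i j U. let v = (p, i); s = (p, j) in
        v \<in> nodes T \<and> s \<notin> nodes T \<and> 2 \<le> card U \<and> (\<forall>u\<in>U. {v, u} \<in> edges T) \<and>
        T' = \<lparr>nodes = insert s (nodes T),
              edges = insert {v, s} ((edges T - (\<lambda>u. {v, u}) ` U) \<union> (\<lambda>u. {s, u}) ` U)\<rparr>)"

text \<open>\<open>is_full_splitting N T S\<close>: the tree \<open>S\<close> is a possible \<open>T\<^sup>*\<close>.\<close>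

definition is_full_splitting :: "point set \<Rightarrow> point ugraph \<Rightarrow> (point \<times> nat) ugraph \<Rightarrow> bool" where
  "is_full_splitting N T S \<longleftrightarrow> split_step\<^sup>*\<^sup>* (tagged T) S \<and>
     (\<forall>v\<in>nodes S. node_degree S v = (if v \<in> (\<lambda>p. (p, 0)) ` N then 1 else 3))"

definition full_splitting :: "point set \<Rightarrow> point ugraph \<Rightarrow> (point \<times> nat) ugraph" where
  "full_splitting N T = (SOME S. is_full_splitting N T S)"

text \<open>
  Here \<open>diameter (fst ` e)\<close> is the distance between the positions of the endpoints of \<open>e\<close>.
\<close>

definition beads :: "point set \<Rightarrow> point ugraph \<Rightarrow> int" where
  "beads N T = 1 - int (card N) + (\<Sum>e\<in>edges (full_splitting N T). \<lceil>diameter (fst ` e)\<rceil>)"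

definition min_steiner_point_tree :: "point set \<Rightarrow> point ugraph \<Rightarrow> bool" where
  "min_steiner_point_tree N T \<longleftrightarrow> interconnects T N \<and>
     (\<forall>T'. interconnects T' N \<longrightarrow> beads N T \<le> beads N T')"


section \<open>The bead count is well defined\<close>

text \<open>
  For at least two terminals a full splitting exists, and the bead count does not depend on its
  choice, since the extra edges have length zero.
\<close>

definition ceil_length :: "(point \<times> nat) set \<Rightarrow> int" where "ceil_length e = \<lceil>diameter (fst ` e)\<rceil>"

definition nbr :: "'a ugraph \<Rightarrow> 'a \<Rightarrow> 'a set" where "nbr T v = {u. {v, u} \<in> edges T}"

lemma simple_graph_edgeD: "simple_graph T \<Longrightarrow> {u,v} \<in> edges T \<Longrightarrow> u \<noteq> v \<and> u \<in> nodes T \<and> v \<in> nodes T"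
  unfolding simple_graph_def by (auto simp: doubleton_eq_iff)

lemma finite_nbr: "simple_graph T \<Longrightarrow> finite (nbr T v)"
  by (rule finite_subset[of _ "nodes T"]) (auto simp: nbr_def simple_graph_def doubleton_eq_iff)

lemma finite_edges: assumes "simple_graph T" shows "finite (edges T)"
proof (rule finite_subset)
  show "edges T \<subseteq> Pow (nodes T)" using assms unfolding simple_graph_def by fastforce
  show "finite (Pow (nodes T))" using assms by (simp add: simple_graph_def)
qed

lemma degree_nbr: assumes "simple_graph T" shows "node_degree T v = card (nbr T v)"
proof -
  have "{e \<in> edges T. v \<in> e} = (\<lambda>u. {v,u}) ` nbr T v"
    using assms unfolding nbr_def simple_graph_def by (fastforce simp: insert_commute)
  moreover have "inj_on (\<lambda>u. {v,u}) (nbr T v)" by (auto simp: inj_on_def doubleton_eq_iff)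
  ultimately show ?thesis by (simp add: node_degree_def card_image)
qed

definition split_graph where "split_graph T v s U = \<lparr>nodes = insert s (nodes T),
              edges = insert {v, s} ((edges T - (\<lambda>u. {v, u}) ` U) \<union> (\<lambda>u. {s, u}) ` U)\<rparr>"

lemma split_graph_simple:
  assumes "simple_graph T" "v \<in> nodes T" "s \<notin> nodes T" "U \<subseteq> nbr T v"
  shows "simple_graph (split_graph T v s U)"
proof -
  have U: "u \<in> nodes T \<and> u \<noteq> v \<and> u \<noteq> s" if "u \<in> U" for u
    using that assms simple_graph_edgeD[OF assms(1)] unfolding nbr_def by blast
  have "\<exists>a\<in>insert s (nodes T). \<exists>b\<in>insert s (nodes T). a \<noteq> b \<and> e = {a, b}" if "e \<in> edges (split_graph T v s U)" for e
  proof -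
    consider "e = {v,s}" | "e \<in> edges T" | u where "u \<in> U" "e = {s,u}" using \<open>e \<in> edges (split_graph T v s U)\<close> by (auto simp: split_graph_def)
    then show ?thesis
    proof cases
      case 1 then show ?thesis using assms(2,3) by (intro bexI[of _ v] bexI[of _ s]) auto
    next
      case 2 then show ?thesis using assms(1) unfolding simple_graph_def by blast
    next
      case 3 then show ?thesis using U[of u] by (intro bexI[of _ s] bexI[of _ u]) auto
    qed
  qed
  then show ?thesis using assms(1) unfolding simple_graph_def by (auto simp: split_graph_def)
qed

lemma split_graph_nbr:
  assumes "simple_graph T" "v \<in> nodes T" "s \<notin> nodes T" "U \<subseteq> nbr T v"
  shows "nbr (split_graph T v s U) v = insert s (nbr T v - U)"
    and "nbr (split_graph T v s U) s = insert v U"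
    and "w \<noteq> v \<Longrightarrow> w \<noteq> s \<Longrightarrow> nbr (split_graph T v s U) w = (if w \<in> U then insert s (nbr T w - {v}) else nbr T w)"
proof -
  have U: "u \<in> nodes T \<and> u \<noteq> v \<and> u \<noteq> s" if "u \<in> U" for u
    using that assms simple_graph_edgeD[OF assms(1)] unfolding nbr_def by blast
  have sE: "{s,u} \<notin> edges T" "{u,s} \<notin> edges T" for u using assms(3) simple_graph_edgeD[OF assms(1)] by blast+
  have vs: "v \<noteq> s" using assms by auto
  have eq: "{w,u} \<in> edges (split_graph T v s U) \<longleftrightarrow> (w = v \<and> u = s) \<or> (w = s \<and> u = v) \<or>
    ({w,u} \<in> edges T \<and> \<not> (w = v \<and> u \<in> U) \<and> \<not> (u = v \<and> w \<in> U)) \<or> (w = s \<and> u \<in> U) \<or> (u = s \<and> w \<in> U)" for w u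
  proof -
    have "{w,u} \<in> edges (split_graph T v s U) \<longleftrightarrow> {w,u} = {v,s} \<or>
        {w,u} \<in> edges T \<and> \<not> (\<exists>x\<in>U. {w,u} = {v,x}) \<or> (\<exists>x\<in>U. {w,u} = {s,x})"
      by (simp add: split_graph_def image_iff)
    then show ?thesis unfolding doubleton_eq_iff by blast
  qed
  show "nbr (split_graph T v s U) v = insert s (nbr T v - U)" using U vs assms(4) sE by (auto simp: nbr_def eq)
  show "nbr (split_graph T v s U) s = insert v U" using U vs assms(4) sE by (auto simp: nbr_def eq)
  show "nbr (split_graph T v s U) w = (if w \<in> U then insert s (nbr T w - {v}) else nbr T w)" if "w \<noteq> v" "w \<noteq> s"
    using U vs assms(4) sE that by (auto simp: nbr_def eq)
qed

lemma split_graph_degree: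
  assumes "simple_graph T" "v \<in> nodes T" "s \<notin> nodes T" "U \<subseteq> nbr T v"
  shows "node_degree (split_graph T v s U) v = node_degree T v - card U + 1"
    and "node_degree (split_graph T v s U) s = card U + 1"
    and "w \<noteq> v \<Longrightarrow> w \<noteq> s \<Longrightarrow> node_degree (split_graph T v s U) w = node_degree T w"
proof -
  note sim = split_graph_simple[OF assms]
  note d = degree_nbr[OF sim] degree_nbr[OF assms(1)]
  have f: "finite (nbr T x)" for x by (rule finite_nbr[OF assms(1)])
  have fU: "finite U" using f assms(4) finite_subset by blast
  have sn: "s \<notin> nbr T x" for x using assms(3) simple_graph_edgeD[OF assms(1)] by (auto simp: nbr_def)
  have vU: "v \<notin> U" using assms(4) simple_graph_edgeD[OF assms(1)] by (auto simp: nbr_def)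
  show "node_degree (split_graph T v s U) v = node_degree T v - card U + 1"
    using f fU sn assms(4) by (simp add: d split_graph_nbr[OF assms] card_Diff_subset)
  show "node_degree (split_graph T v s U) s = card U + 1"
    using fU vU by (simp add: d split_graph_nbr[OF assms])
  show "node_degree (split_graph T v s U) w = node_degree T w" if "w \<noteq> v" "w \<noteq> s"
  proof (cases "w \<in> U")
    case True
    then have "v \<in> nbr T w" using assms(4) by (auto simp: nbr_def insert_commute)
    then have "card (nbr T w) > 0" using f card_gt_0_iff by blast
    then show ?thesis using True \<open>v \<in> nbr T w\<close> f sn by (simp add: d split_graph_nbr(3)[OF assms that])
  qed (simp add: d split_graph_nbr(3)[OF assms that])
qed

lemma split_step_split_graph: "split_step T T' \<longleftrightarrow> (\<exists>p i j U. (p,i) \<in> nodes T \<and> (p,j) \<notin> nodes T \<and> 2 \<le> card U \<and> U \<subseteq> nbr T (p,i) \<and>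
   T' = split_graph T (p,i) (p,j) U)"
  unfolding split_step_def split_graph_def nbr_def Let_def by (simp add: subset_eq)

lemma split_graph_sum:
  assumes "simple_graph T" "v \<in> nodes T" "s \<notin> nodes T" "U \<subseteq> nbr T v" "fst s = fst v"
  shows "sum ceil_length (edges (split_graph T v s U)) = sum ceil_length (edges T)"
proof -
  have U: "u \<in> nodes T \<and> u \<noteq> v \<and> u \<noteq> s" if "u \<in> U" for u
    using that assms simple_graph_edgeD[OF assms(1)] unfolding nbr_def by blast
  have vs: "v \<noteq> s" using assms by auto
  have sE: "{s,u} \<notin> edges T" "{u,s} \<notin> edges T" for u using assms(3) simple_graph_edgeD[OF assms(1)] by blast+
  let ?A = "(\<lambda>u. {v, u}) ` U" and ?B = "(\<lambda>u. {s, u}) ` U"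
  have fU: "finite U" using finite_nbr[OF assms(1)] assms(4) finite_subset by blast
  have fE: "finite (edges T)" by (rule finite_edges[OF assms(1)])
  have AE: "?A \<subseteq> edges T" using assms(4) by (auto simp: nbr_def)
  have "sum ceil_length ?B = sum ceil_length ?A"
    by (subst sum.reindex, force simp: inj_on_def doubleton_eq_iff, subst sum.reindex, force simp: inj_on_def doubleton_eq_iff)
       (simp add: ceil_length_def assms(5))
  moreover have "ceil_length {v,s} = 0" by (simp add: ceil_length_def assms(5))
  moreover have "v \<notin> U" using U by blast
  then have "{v,s} \<notin> (edges T - ?A) \<union> ?B" using sE vs by (auto simp: doubleton_eq_iff)
  moreover have "(edges T - ?A) \<inter> ?B = {}" using sE by auto
  moreover have "sum ceil_length (edges T - ?A) = sum ceil_length (edges T) - sum ceil_length ?A"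
    using AE fE by (simp add: sum_diff)
  ultimately show ?thesis using fE fU by (simp add: split_graph_def sum.union_disjoint)
qed

lemma split_steps_sum: "split_step\<^sup>*\<^sup>* T S \<Longrightarrow> simple_graph T \<Longrightarrow> simple_graph S \<and> sum ceil_length (edges S) = sum ceil_length (edges T)"
proof (induction rule: rtranclp_induct)
  case (step y z)
  then show ?case unfolding split_step_split_graph by (auto simp: split_graph_simple split_graph_sum)
qed auto

definition splittable where "splittable M T \<longleftrightarrow> simple_graph T \<and> M \<subseteq> nodes T \<and> (\<forall>v\<in>nodes T. (if v \<in> M then 1 else 3) \<le> node_degree T v)"
definition excess where "excess M T v = (if v \<in> M then 3 * (node_degree T v - 1) else node_degree T v - 3)"

lemma exists_split: "splittable M (T :: (point \<times> nat) ugraph) \<Longrightarrow> \<exists>S. split_step\<^sup>*\<^sup>* T S \<and> (\<forall>v\<in>nodes S. node_degree S v = (if v \<in> M then 1 else 3))"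
proof (induction "sum (excess M T) (nodes T)" arbitrary: T rule: less_induct)
  case less
  show ?case
  proof (cases "\<forall>v\<in>nodes T. node_degree T v = (if v \<in> M then 1 else 3)")
    case True then show ?thesis by blast
  next
    case False
    then obtain v where v: "v \<in> nodes T" and dv: "node_degree T v > (if v \<in> M then 1 else 3)"
      using less.prems unfolding splittable_def by (metis le_neq_implies_less)
    have sg: "simple_graph T" and MT: "M \<subseteq> nodes T" and lb: "\<And>v. v \<in> nodes T \<Longrightarrow> (if v \<in> M then 1 else 3) \<le> node_degree T v" using less.prems by (auto simp: splittable_def)
    have fn: "finite (nodes T)" using sg by (simp add: simple_graph_def)
    obtain j where j: "(fst v, j) \<notin> nodes T"
    proof -
      have "\<exists>j. j \<notin> snd ` nodes T" using fn by (meson ex_new_if_finite finite_imageI infinite_UNIV_nat)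
      then show ?thesis using that by force
    qed
    define s where "s = (fst v, j)"
    have s: "s \<notin> nodes T" "fst s = fst v" using j by (auto simp: s_def)
    have "\<exists>U \<subseteq> nbr T v. card U = (if v \<in> M then node_degree T v else 2)"
    proof (cases "v \<in> M")
      case True
      then show ?thesis using degree_nbr[OF sg, of v] by auto
    next
      case False
      then have "2 \<le> card (nbr T v)" using dv degree_nbr[OF sg, of v] by simp
      then show ?thesis using False obtain_subset_with_card_n by (metis (no_types, lifting))
    qed
    then obtain U where U: "U \<subseteq> nbr T v" "card U = (if v \<in> M then node_degree T v else 2)" by blast
    let ?T = "split_graph T v s U"
    have st: "split_step T ?T" unfolding split_step_split_graph
      using v s U dv by (intro exI[of _ "fst v"] exI[of _ "snd v"] exI[of _ j] exI[of _ U]) (auto simp: s_def)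
    note dg = split_graph_degree[OF sg v s(1) U(1)]
    have sM: "s \<notin> M" using s MT by auto
    have nT: "nodes ?T = insert s (nodes T)" by (simp add: split_graph_def)
    have splittable: "splittable M ?T" unfolding splittable_def
    proof (intro conjI ballI)
      show "simple_graph ?T" by (rule split_graph_simple[OF sg v s(1) U(1)])
      show "M \<subseteq> nodes ?T" using MT nT by auto
      fix w assume "w \<in> nodes ?T"
      then consider "w = s" | "w = v" | "w \<noteq> v" "w \<noteq> s" "w \<in> nodes T" using nT by auto
      then show "(if w \<in> M then 1 else 3) \<le> node_degree ?T w"
        by cases (use dg U(2) dv sM lb in \<open>auto split: if_splits\<close>)
    qed
    have "sum (excess M ?T) (nodes ?T) = excess M ?T s + excess M ?T v + sum (excess M ?T) (nodes T - {v})"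
      using s(1) fn v by (simp add: nT, subst sum.remove[of _ v]) auto
    also have "sum (excess M ?T) (nodes T - {v}) = sum (excess M T) (nodes T - {v})"
      proof (rule sum.cong[OF refl])
      fix w assume "w \<in> nodes T - {v}"
      then have "node_degree ?T w = node_degree T w" using s(1) by (intro dg(3)) auto
      then show "excess M ?T w = excess M T w" by (simp add: excess_def)
    qed
    also have "excess M ?T s + excess M ?T v < excess M T v"
      using dg(1,2) U(2) dv sM by (auto simp: excess_def split: if_splits)
    also have "excess M T v + sum (excess M T) (nodes T - {v}) = sum (excess M T) (nodes T)"
      using fn v by (simp add: sum.remove[of _ v])
    finally have "\<exists>S. split_step\<^sup>*\<^sup>* ?T S \<and> (\<forall>v\<in>nodes S. node_degree S v = (if v \<in> M then 1 else 3))"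
      using less.hyps splittable by auto
    then show ?thesis using st by (meson converse_rtranclp_into_rtranclp)
  qed
qed

lemma tagged_simple: "simple_graph T \<Longrightarrow> simple_graph (tagged T)"
  unfolding simple_graph_def tagged_def by fastforce

lemma tagged_degree: "node_degree (tagged T) (p, 0) = node_degree T p"
proof -
  have "{e \<in> edges (tagged T). (p,0) \<in> e} = (\<lambda>e. (\<lambda>p. (p, 0)) ` e) ` {e \<in> edges T. p \<in> e}"
    by (auto simp: tagged_def)
  moreover have "inj ((`) (\<lambda>p::point. (p, 0::nat)))" 
    by (rule injI) (simp add: inj_image_eq_iff inj_def)
  ultimately show ?thesis by (simp add: node_degree_def card_image inj_on_subset)
qed

lemma connected_degree: assumes "simple_graph T" "connected_graph T" "u \<in> nodes T" "v \<in> nodes T" "u \<noteq> v"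
  shows "1 \<le> node_degree T u"
proof -
  have "(u,v) \<in> {(x, y). {x, y} \<in> edges T}\<^sup>*" using assms by (auto simp: connected_graph_def)
  then obtain w where "{u,w} \<in> edges T" using assms(5) by (auto elim: converse_rtranclE)
  then have "nbr T u \<noteq> {}" by (auto simp: nbr_def)
  then show ?thesis using finite_nbr[OF assms(1), of u] degree_nbr[OF assms(1)] by (metis card_0_eq le_numeral_extra(3) less_one not_le)
qed

theorem full_splitting_ok:
  assumes "interconnects T N" "2 \<le> card N"
  shows "is_full_splitting N T (full_splitting N T)"
    and "beads N T = 1 - int (card N) + (\<Sum>e\<in>edges T. \<lceil>diameter e\<rceil>)"
proof -
  have sg: "simple_graph T" and cg: "connected_graph T" and NT: "N \<subseteq> nodes T"
    and d3: "\<And>w. w \<in> nodes T - N \<Longrightarrow> 3 \<le> node_degree T w" using assms by (auto simp: interconnects_def tree_def)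
  have "1 \<le> node_degree T p" if "p \<in> N" for p
  proof -
    obtain q where "q \<in> N" "q \<noteq> p" using assms(2) that
      by (metis One_nat_def Suc_1 card_1_singleton_iff card_eq_0_iff card_le_Suc0_iff_eq not_less_eq_eq nat_le_linear zero_le)
    then show ?thesis using connected_degree[OF sg cg] NT that by blast
  qed
  then have "splittable ((\<lambda>p. (p, 0)) ` N) (tagged T)"
    unfolding splittable_def using tagged_simple[OF sg] NT d3 by (auto simp: tagged_def[of T] tagged_degree[unfolded tagged_def])
  from exists_split[OF this] show fs: "is_full_splitting N T (full_splitting N T)"
    unfolding full_splitting_def by (intro someI_ex[of "is_full_splitting N T"]) (auto simp: is_full_splitting_def)
  have "sum ceil_length (edges (full_splitting N T)) = sum ceil_length (edges (tagged T))"
    using fs split_steps_sum tagged_simple[OF sg] by (auto simp: is_full_splitting_def)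
  also have "\<dots> = (\<Sum>e\<in>edges T. \<lceil>diameter e\<rceil>)"
    unfolding tagged_def by (simp add: sum.reindex inj_on_def inj_image_eq_iff ceil_length_def image_image)
  finally show "beads N T = 1 - int (card N) + (\<Sum>e\<in>edges T. \<lceil>diameter e\<rceil>)" by (simp add: beads_def ceil_length_def)
qed

end

theory Submission
  imports Defs
begin

text \<open>
  Hang \<open>G\<close> at a terminal \<open>r\<close> and embed the resulting binary tree with all angles equal to 120
  degrees, edges at level \<open>h\<close> having length \<open>400 ^ h + c / 2\<close> for a small \<open>c\<close>.  That this is a Steiner
  minimal tree follows from a dual certificate: functions \<open>psi D\<close>, indexed by sets \<open>D\<close> of terminals,
  that are 1-Lipschitz, subadditive in disjoint \<open>D\<close> and zero at \<open>v\<close> if \<open>D = {v}\<close> bound the length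
  of every tree from below by the value of \<open>psi (N - {r})\<close> at \<open>r\<close>, by induction along the tree.

  The first-order changes of edge lengths under motions of the Steiner points are exactly the vectors
  with sum zero, so the Steiner points can move such that every edge but the one at \<open>r\<close> shrinks at
  unit rate.  Moving for time \<open>c\<close> brings all these \<open>2 * n - 4\<close> edges to at most their integer parts
  and keeps the edge at \<open>r\<close> below the next integer.  The resulting tree is optimal because the
  ceilings of the lengths of any tree sum to at least the ceiling of the minimal total length.
\<close>

section \<open>Rooted trees\<close>

text \<open>Joining two trees by an edge between their roots adds one branch at \<open>r\<close> at
  a time. Nodes may have any degree, so the same induction serves the binary decomposition of the
  topology and the lower bound for arbitrary competitors.\<close>

inductive rooted :: "'a \<Rightarrow> 'a set \<Rightarrow> 'a set set \<Rightarrow> bool" where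
  single: "rooted r {r} {}"
| join: "rooted r V E \<Longrightarrow> rooted s W F \<Longrightarrow> V \<inter> W = {} \<Longrightarrow> rooted r (V \<union> W) (insert {r, s} (E \<union> F))"

lemma rooted_finite: "rooted r V E \<Longrightarrow> finite V \<and> finite E \<and> r \<in> V \<and> E \<subseteq> Pow V"
  by (induction rule: rooted.induct) auto

lemma rooted_nonempty: "rooted r V E \<Longrightarrow> e \<in> E \<Longrightarrow> e \<noteq> {}"
  by (induction rule: rooted.induct) auto

lemma rooted_add_leaf:
  assumes "rooted r V E" "y \<in> V" "x \<notin> V"
  shows "rooted r (insert x V) (insert {y, x} E)"
  using assms
proof (induction rule: rooted.induct)
  case (single r)
  then show ?case using rooted.join[OF rooted.single rooted.single, of r x] by (simp add: insert_commute)
next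
  case (join r V E s W F)
  show ?case
  proof (cases "y \<in> V")
    case True
    then have "rooted r (insert x V) (insert {y, x} E)" using join by auto
    from rooted.join[OF this join.hyps(2)] show ?thesis using join by (simp add: insert_commute)
  next
    case False
    then have "rooted s (insert x W) (insert {y, x} F)" using join by auto
    from rooted.join[OF join.hyps(1) this] show ?thesis using join by (simp add: insert_commute)
  qed
qed

lemma rtrancl_edges_sym:
  "(u, v) \<in> {(x, y). {x, y} \<in> E}\<^sup>* \<Longrightarrow> (v, u) \<in> {(x, y). {x, y} \<in> E}\<^sup>*"
  by (rule symD[OF sym_rtrancl]) (auto simp: sym_def insert_commute)

lemma rooted_connected: "rooted r V E \<Longrightarrow> u \<in> V \<Longrightarrow> (r, u) \<in> {(x, y). {x, y} \<in> E}\<^sup>*"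
proof (induction arbitrary: u rule: rooted.induct)
  case (join r V E s W F)
  let ?E = "insert {r, s} (E \<union> F)"
  have mono: "{(x, y). {x, y} \<in> E}\<^sup>* \<subseteq> {(x, y). {x, y} \<in> ?E}\<^sup>*"
    "{(x, y). {x, y} \<in> F}\<^sup>* \<subseteq> {(x, y). {x, y} \<in> ?E}\<^sup>*" by (intro rtrancl_mono; auto)+
  have rs: "(r, s) \<in> {(x, y). {x, y} \<in> ?E}" by simp
  show ?case
  proof (cases "u \<in> V")
    case True then show ?thesis using join.IH(1) mono by blast
  next
    case False
    then have "(s, u) \<in> {(x, y). {x, y} \<in> ?E}\<^sup>*" using join mono by blast
    then show ?thesis using rs by (rule converse_rtrancl_into_rtrancl[rotated])
  qed
qed auto

lemma simple_path:
  assumes "(u, v) \<in> {(x, y). {x, y} \<in> E}\<^sup>*"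
  shows "\<exists>p. p \<noteq> [] \<and> hd p = u \<and> last p = v \<and> distinct p \<and> successively (\<lambda>a b. {a, b} \<in> E) p"
  using assms
proof (induction rule: converse_rtrancl_induct)
  case base
  show ?case by (intro exI[of _ "[v]"]) auto
next
  case (step u z)
  then obtain p where p: "p \<noteq> []" "hd p = z" "last p = v" "distinct p" "successively (\<lambda>a b. {a, b} \<in> E) p" by blast
  show ?case
  proof (cases "u \<in> set p")
    case True
    \<comment> \<open>If \<open>u\<close> already lies on the path, the part before it is cut
      off.\<close>
    then obtain ys zs where "p = ys @ u # zs" by (meson split_list)
    then show ?thesis using p by (intro exI[of _ "u # zs"]) (auto simp: successively_append_iff)
  next
    case False
    then show ?thesis using p step(1)
      by (intro exI[of _ "u # p"]) (auto simp: successively_Cons)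
  qed
qed

text \<open>A rooted subgraph with the largest possible node set reaches every node, since otherwise
  connectedness would provide a leaf to attach. It contains every edge, since a missing edge would
  close a cycle with the path between its ends.\<close>

lemma tree_rooted:
  assumes "tree T" "r \<in> nodes T"
  shows "rooted r (nodes T) (edges T)"
proof -
  have sg: "simple_graph T" and cg: "connected_graph T" and nc: "\<not> (\<exists>p. is_cycle T p)"
    using assms by (auto simp: tree_def)
  have fin: "finite (nodes T)" using sg by (simp add: simple_graph_def)
  define P where "P V \<longleftrightarrow> V \<subseteq> nodes T \<and> (\<exists>E\<subseteq>edges T. rooted r V E)" for V
  have "P {r}" using assms(2) rooted.single unfolding P_def by fastforce
  moreover have "\<forall>V. P V \<longrightarrow> card V < Suc (card (nodes T))"
    using card_mono[OF fin] by (auto simp: P_def less_Suc_eq_le)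
  ultimately obtain V where V: "P V" and maxi: "\<And>W. P W \<Longrightarrow> card W \<le> card V"
    using ex_has_greatest_nat[of P "{r}" card] by blast
  obtain E where E: "V \<subseteq> nodes T" "E \<subseteq> edges T" "rooted r V E" using V by (auto simp: P_def)
  note fV = rooted_finite[OF E(3)]
  have closed: "y \<in> V" if "x \<in> V" "{x, y} \<in> edges T" for x y
  proof (rule ccontr)
    assume y: "y \<notin> V"
    have "P (insert y V)" unfolding P_def
      using rooted_add_leaf[OF E(3) that(1) y] that E simple_graph_edgeD[OF sg that(2)] by blast
    then show False using maxi[of "insert y V"] y fV by auto
  qed
  have "z \<in> V" if "z \<in> nodes T" for z
  proof -
    have "(r, z) \<in> {(x, y). {x, y} \<in> edges T}\<^sup>*" using cg assms(2) that by (auto simp: connected_graph_def)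
    then show ?thesis by (induction rule: rtrancl_induct) (use fV closed in auto)
  qed
  then have VT: "V = nodes T" using E(1) by auto
  have "e \<in> E" if e: "e \<in> edges T" for e
  proof (rule ccontr)
    assume nE: "e \<notin> E"
    obtain x y where xy: "x \<in> V" "y \<in> V" "x \<noteq> y" "e = {x, y}"
      using e sg VT by (auto simp: simple_graph_def)
    have "(x, y) \<in> {(x, y). {x, y} \<in> E}\<^sup>*"
      using rtrancl_trans[OF rtrancl_edges_sym[OF rooted_connected[OF E(3) xy(1)]] rooted_connected[OF E(3) xy(2)]] .
    from simple_path[OF this] obtain p where p: "p \<noteq> []" "hd p = x" "last p = y" "distinct p"
      "successively (\<lambda>a b. {a, b} \<in> E) p" by blast
    have l2: "length p \<noteq> 1" using p xy by (cases p) auto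
    \<comment> \<open>A path with two nodes would consist of \<open>e\<close> itself, which is not
      in \<open>E\<close>.\<close>
    have "length p \<noteq> 2"
      using p xy nE by (auto simp: length_Suc_conv numeral_2_eq_2)
    moreover have "length p \<noteq> 0" using p(1) by simp
    ultimately have l3: "3 \<le> length p" using l2 by linarith
    have step: "{p ! i, p ! Suc i} \<in> edges T" if "Suc i < length p" for i
      using p(5) that E(2) by (auto simp: successively_conv_nth)
    have "{p ! i, p ! (Suc i mod length p)} \<in> edges T" if "i < length p" for i
    proof (cases "Suc i < length p")
      case True then show ?thesis using step by simp
    next
      case False
      then have "Suc i = length p" using that by simp
      then have "length p - 1 = i" "Suc i mod length p = 0" by auto
      then have "p ! i = y" "p ! (Suc i mod length p) = x"
        using p(1-3) by (simp_all add: last_conv_nth hd_conv_nth)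
      then show ?thesis using e xy by (simp add: insert_commute)
    qed
    then have "is_cycle T p" using l3 p(4) by (simp add: is_cycle_def)
    then show False using nc by blast
  qed
  then have "E = edges T" using E(2) by blast
  then show ?thesis using E(3) VT by simp
qed

section \<open>Full Steiner topologies as binary trees\<close>

datatype 'a bt = Leaf 'a | Node 'a "'a bt" "'a bt"

primrec rt :: "'a bt \<Rightarrow> 'a" where
  "rt (Leaf a) = a"
| "rt (Node s A B) = s"

primrec leaves :: "'a bt \<Rightarrow> 'a set" where
  "leaves (Leaf a) = {a}"
| "leaves (Node s A B) = leaves A \<union> leaves B"

primrec bt_edges :: "'a bt \<Rightarrow> 'a set set" where
  "bt_edges (Leaf a) = {}"
| "bt_edges (Node s A B) = {{s, rt A}, {s, rt B}} \<union> bt_edges A \<union> bt_edges B"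

primrec distinct_bt :: "'a bt \<Rightarrow> bool" where
  "distinct_bt (Leaf a) \<longleftrightarrow> True"
| "distinct_bt (Node s A B) \<longleftrightarrow> s \<notin> set_bt A \<union> set_bt B \<and> set_bt A \<inter> set_bt B = {} \<and>
     distinct_bt A \<and> distinct_bt B"

primrec height :: "'a bt \<Rightarrow> nat" where
  "height (Leaf a) = 0"
| "height (Node s A B) = Suc (max (height A) (height B))"

lemma rt_in_set [simp]: "rt t \<in> set_bt t"
  by (cases t) auto

lemma leaves_subset: "leaves t \<subseteq> set_bt t"
  by (induction t) auto

lemma leaves_nonempty [simp]: "leaves t \<noteq> {}"
  by (induction t) auto

lemma finite_leaves [simp]: "finite (leaves t)"
  by (induction t) auto

lemma finite_bt_edges [simp]: "finite (bt_edges t)"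
  by (induction t) auto

lemma bt_edges_subset: "e \<in> bt_edges t \<Longrightarrow> e \<subseteq> set_bt t"
  by (induction t) auto

lemma bt_edges_nonempty: "e \<in> bt_edges t \<Longrightarrow> e \<noteq> {}"
  by (induction t) auto

lemma sum_bt_edges_Node:
  assumes "distinct_bt (Node s A B)"
  shows "sum g (bt_edges (Node s A B)) =
    g {s, rt A} + g {s, rt B} + sum g (bt_edges A) + (sum g (bt_edges B) :: 'b :: comm_monoid_add)"
proof -
  have d: "s \<notin> set_bt A" "s \<notin> set_bt B" "set_bt A \<inter> set_bt B = {}" using assms by auto
  have "e \<notin> bt_edges B" if "e \<in> bt_edges A" for e
    using bt_edges_subset[of e A] bt_edges_subset[of e B] bt_edges_nonempty[OF that] that d(3) by auto
  then have "bt_edges A \<inter> bt_edges B = {}" by auto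
  moreover have "{s, x} \<notin> bt_edges A \<union> bt_edges B" for x
    using d(1,2) bt_edges_subset[of "{s, x}" A] bt_edges_subset[of "{s, x}" B] by auto
  moreover have "{s, rt A} \<noteq> {s, rt B}"
    using d(3) rt_in_set[of A] rt_in_set[of B] by (auto simp: doubleton_eq_iff simp del: rt_in_set)
  ultimately show ?thesis by (simp add: sum.union_disjoint add.assoc)
qed

lemma card_bt_edges:
  assumes "distinct_bt t" shows "card (bt_edges t) + 2 = 2 * card (leaves t)"
  using assms
proof (induction t)
  case (Node s A B)
  have "leaves A \<inter> leaves B = {}" using Node.prems leaves_subset[of A] leaves_subset[of B] by auto
  then have "card (leaves A \<union> leaves B) = card (leaves A) + card (leaves B)"
    by (simp add: card_Un_disjoint)
  then show ?case using Node sum_bt_edges_Node[OF Node.prems, of "\<lambda>_. 1::nat"] by simp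
qed simp

primrec disjoint_bts :: "'a bt list \<Rightarrow> bool" where
  "disjoint_bts [] \<longleftrightarrow> True"
| "disjoint_bts (t # ts) \<longleftrightarrow> set_bt t \<inter> (\<Union>u\<in>set ts. set_bt u) = {} \<and> disjoint_bts ts"

text \<open>The list holds the branches at \<open>r\<close>, one per incident edge. Any other node
  spends one edge on its parent, so degree 1 or 3 leaves 0 or 2 children, and its branch is a
  \<open>Leaf\<close> or a \<open>Node\<close>. The root is exempt because within a partial tree the
  edge to its parent is still missing.\<close>

lemma rooted_bts:
  assumes "rooted r V E" "\<And>v. v \<in> V - {r} \<Longrightarrow> card {e\<in>E. v \<in> e} \<in> {1, 3}"
  shows "\<exists>ts. length ts = card {e\<in>E. r \<in> e} \<and> insert r (\<Union>t\<in>set ts. set_bt t) = V \<and>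
     E = (\<Union>t\<in>set ts. insert {r, rt t} (bt_edges t)) \<and>
     (\<forall>t\<in>set ts. distinct_bt t \<and> r \<notin> set_bt t) \<and> disjoint_bts ts \<and>
     (\<Union>t\<in>set ts. leaves t) = {v\<in>V - {r}. card {e\<in>E. v \<in> e} = 1}"
  using assms
proof (induction rule: rooted.induct)
  case (single r)
  show ?case by (rule exI[of _ "[]"]) auto
next
  case (join r V E s W F)
  let ?E = "insert {r, s} (E \<union> F)"
  note V = rooted_finite[OF join.hyps(1)] and W = rooted_finite[OF join.hyps(2)]
  have VE: "v \<in> V \<and> v \<notin> W" if "e \<in> E" "v \<in> e" for e v
    using that V join.hyps(3) by (meson PowD disjoint_iff subsetD)
  have WF: "v \<in> W \<and> v \<notin> V" if "e \<in> F" "v \<in> e" for e v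
    using that W join.hyps(3) by (meson PowD disjoint_iff subsetD)
  have rs: "r \<notin> W" "s \<notin> V" "r \<in> V" "s \<in> W" using V W join.hyps(3) by auto
  have degV: "{e\<in>?E. v \<in> e} = {e\<in>E. v \<in> e}" if "v \<in> V - {r}" for v
    using that rs WF by auto
  have degW: "{e\<in>?E. v \<in> e} = {e\<in>F. v \<in> e}" if "v \<in> W - {s}" for v
    using that rs VE by auto
  have "{r, s} \<notin> E" "{r, s} \<notin> F" using VE WF rs by (metis insertCI)+
  moreover have "{e\<in>?E. r \<in> e} = insert {r, s} {e\<in>E. r \<in> e}" "{e\<in>?E. s \<in> e} = insert {r, s} {e\<in>F. s \<in> e}"
    using VE WF rs by auto
  ultimately have degr: "card {e\<in>?E. r \<in> e} = Suc (card {e\<in>E. r \<in> e})"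
    and degs: "card {e\<in>?E. s \<in> e} = Suc (card {e\<in>F. s \<in> e})" using V W by auto
  have "card {e\<in>E. v \<in> e} \<in> {1, 3}" if "v \<in> V - {r}" for v
    using join.prems[of v] degV[OF that] that by auto
  from join.IH(1)[OF this] obtain ts where ts: "length ts = card {e\<in>E. r \<in> e}"
    "insert r (\<Union>t\<in>set ts. set_bt t) = V" "E = (\<Union>t\<in>set ts. insert {r, rt t} (bt_edges t))"
    "\<forall>t\<in>set ts. distinct_bt t \<and> r \<notin> set_bt t" "disjoint_bts ts"
    "(\<Union>t\<in>set ts. leaves t) = {v\<in>V - {r}. card {e\<in>E. v \<in> e} = 1}" by blast
  have "card {e\<in>F. v \<in> e} \<in> {1, 3}" if "v \<in> W - {s}" for v
    using join.prems[of v] degW[OF that] that rs by auto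
  from join.IH(2)[OF this] obtain us where us: "length us = card {e\<in>F. s \<in> e}"
    "insert s (\<Union>t\<in>set us. set_bt t) = W" "F = (\<Union>t\<in>set us. insert {s, rt t} (bt_edges t))"
    "\<forall>t\<in>set us. distinct_bt t \<and> s \<notin> set_bt t" "disjoint_bts us"
    "(\<Union>t\<in>set us. leaves t) = {v\<in>W - {s}. card {e\<in>F. v \<in> e} = 1}" by blast
  have s13: "card {e\<in>?E. s \<in> e} \<in> {1, 3}" using join.prems[of s] W rs V by auto
  have "\<exists>t. rt t = s \<and> set_bt t = W \<and> bt_edges t = F \<and> distinct_bt t \<and>
      leaves t = {v\<in>W. card {e\<in>?E. v \<in> e} = 1}"
  proof -
    \<comment> \<open>Degrees are taken in the joined graph: a node \<open>s\<close> without
      children has degree 0 in \<open>F\<close> and becomes a leaf only through the edge to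
      \<open>r\<close>.\<close>
    have lW: "{v\<in>W. card {e\<in>?E. v \<in> e} = 1} =
        {v\<in>W - {s}. card {e\<in>F. v \<in> e} = 1} \<union> (if card {e\<in>?E. s \<in> e} = 1 then {s} else {})"
    proof -
      define d where "d v = card {e\<in>?E. v \<in> e}" for v
      define d' where "d' v = card {e\<in>F. v \<in> e}" for v
      have dd: "d v = d' v" if "v \<in> W - {s}" for v unfolding d_def d'_def degW[OF that] ..
      have "v \<in> {v\<in>W. d v = 1} \<longleftrightarrow> v \<in> {v\<in>W - {s}. d' v = 1} \<union> (if d s = 1 then {s} else {})" for v
        using rs(4) dd[of v] by (cases "v \<in> W - {s}") auto
      then show ?thesis unfolding d_def[symmetric] d'_def[symmetric] by (rule set_eqI)
    qed
    consider "length us = 0" | "length us = 2" using s13 degs us(1) by auto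
    then show ?thesis
    proof cases
      case 1
      then have "us = []" "card {e\<in>?E. s \<in> e} = 1" using us(1) degs by auto
      then show ?thesis unfolding lW us(6)[symmetric] using us(2,3)
        by (intro exI[of _ "Leaf s"]) simp
    next
      case 2
      then obtain A B where AB: "us = [A, B]" by (auto simp: length_Suc_conv numeral_2_eq_2)
      have "card {e\<in>?E. s \<in> e} \<noteq> 1" using 2 us(1) degs by simp
      moreover have "distinct_bt (Node s A B)" using us(4,5) AB by simp
      moreover have "set_bt (Node s A B) = W" using us(2) AB by auto
      moreover have "bt_edges (Node s A B) = F" using us(3) AB by auto
      ultimately show ?thesis unfolding lW us(6)[symmetric] using AB
        by (intro exI[of _ "Node s A B"]) simp
    qed
  qed
  then obtain t where t: "rt t = s" "set_bt t = W" "bt_edges t = F" "distinct_bt t"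
    "leaves t = {v\<in>W. card {e\<in>?E. v \<in> e} = 1}" by blast
  have "(\<Union>u\<in>set (t # ts). leaves u) = {v \<in> V \<union> W - {r}. card {e \<in> ?E. v \<in> e} = 1}"
  proof -
    have "{v \<in> V \<union> W - {r}. card {e \<in> ?E. v \<in> e} = 1} =
        {v\<in>W. card {e\<in>?E. v \<in> e} = 1} \<union> {v\<in>V - {r}. card {e\<in>?E. v \<in> e} = 1}"
      using rs by blast
    also have "{v\<in>V - {r}. card {e\<in>?E. v \<in> e} = 1} = {v\<in>V - {r}. card {e\<in>E. v \<in> e} = 1}"
      by (rule Collect_cong, rule conj_cong[OF refl], simp only: degV)
    finally show ?thesis using ts(6) t(5) by simp
  qed
  moreover have "insert r (\<Union>u\<in>set (t # ts). set_bt u) = V \<union> W"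
    using ts(2) t(2) by auto
  moreover have "?E = (\<Union>u\<in>set (t # ts). insert {r, rt u} (bt_edges u))"
    unfolding ts(3) using t(1,3) by auto
  moreover have "disjoint_bts (t # ts)"
  proof -
    have "set_bt t \<inter> (\<Union>u\<in>set ts. set_bt u) \<subseteq> W \<inter> V" using ts(2) t(2) by blast
    then show ?thesis using ts(5) join.hyps(3) by auto
  qed
  ultimately show ?case
    using degr ts(1,4) t(2,4) rs(1) by (intro exI[of _ "t # ts"] conjI) simp_all
qed

text \<open>A terminal \<open>r\<close> has degree one, so rooting there leaves a single branch
  \<open>t\<close>; its inner nodes are the Steiner points.\<close>

lemma full_topology_bt:
  assumes "full_steiner_topology n X G"
  obtains r t where "r \<in> X" "distinct_bt t" "r \<notin> set_bt t" "nodes G = insert r (set_bt t)"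
    "edges G = insert {r, rt t} (bt_edges t)" "leaves t = X - {r}"
proof -
  have G: "tree G" "X \<subseteq> nodes G" "card X = n" "card (nodes G - X) + 2 = n"
    "\<And>x. x \<in> X \<Longrightarrow> node_degree G x = 1" "\<And>x. x \<in> nodes G - X \<Longrightarrow> node_degree G x = 3"
    using assms by (auto simp: full_steiner_topology_def)
  have "X \<noteq> {}" using G by auto
  then obtain r where r: "r \<in> X" by blast
  have rG: "rooted r (nodes G) (edges G)" by (rule tree_rooted[OF G(1) subsetD[OF G(2) r]])
  have "card {e \<in> edges G. v \<in> e} \<in> {1, 3}" if "v \<in> nodes G - {r}" for v
    using G(5)[of v] G(6)[of v] that by (cases "v \<in> X") (auto simp: node_degree_def)
  then have "\<exists>ts. length ts = card {e\<in>edges G. r \<in> e} \<and>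
      insert r (\<Union>t\<in>set ts. set_bt t) = nodes G \<and>
      edges G = (\<Union>t\<in>set ts. insert {r, rt t} (bt_edges t)) \<and>
      (\<forall>t\<in>set ts. distinct_bt t \<and> r \<notin> set_bt t) \<and> disjoint_bts ts \<and>
      (\<Union>t\<in>set ts. leaves t) = {v\<in>nodes G - {r}. card {e\<in>edges G. v \<in> e} = 1}"
    by (rule rooted_bts[OF rG])
  then obtain ts where ts: "length ts = card {e\<in>edges G. r \<in> e}"
    "insert r (\<Union>t\<in>set ts. set_bt t) = nodes G" "edges G = (\<Union>t\<in>set ts. insert {r, rt t} (bt_edges t))"
    "\<forall>t\<in>set ts. distinct_bt t \<and> r \<notin> set_bt t"
    "(\<Union>t\<in>set ts. leaves t) = {v\<in>nodes G - {r}. card {e\<in>edges G. v \<in> e} = 1}"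
    by (elim exE conjE)
  have "length ts = 1" using ts(1) G(5)[OF r] by (simp add: node_degree_def)
  then obtain t where t: "ts = [t]" by (auto simp: length_Suc_conv)
  have "v \<in> {v\<in>nodes G - {r}. card {e\<in>edges G. v \<in> e} = 1} \<longleftrightarrow> v \<in> X - {r}" for v
    using G(2) G(5,6)[of v] unfolding node_degree_def by (cases "v \<in> X") auto
  then have "{v\<in>nodes G - {r}. card {e\<in>edges G. v \<in> e} = 1} = X - {r}" by (rule set_eqI)
  then show ?thesis using that[of r t] r ts t by simp
qed

section \<open>Embedding a binary tree with rapidly decreasing edge lengths\<close>

text \<open>Rotation by 60 degrees; \<open>rgt\<close> is the rotation the other way. An edge
  arriving in direction \<open>w\<close> and edges leaving in directions \<open>lft w\<close> and
  \<open>rgt w\<close> meet at 120 degrees, and \<open>lft w + rgt w = w\<close> is the equilibrium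
  of forces.\<close>

definition lft :: "point \<Rightarrow> point" where
  "lft w = (\<chi> i. if i = 1 then w$1 / 2 - sqrt 3 / 2 * w$2 else w$2 / 2 + sqrt 3 / 2 * w$1)"

definition rgt :: "point \<Rightarrow> point" where
  "rgt w = w - lft w"

lemma lft_rgt: "lft w + rgt w = w"
  by (simp add: rgt_def)

lemma inner_lft_rgt:
  assumes "norm w = 1"
  shows "lft w \<bullet> lft w = 1" "rgt w \<bullet> rgt w = 1" "lft w \<bullet> rgt w = - 1/2" "rgt w \<bullet> lft w = - 1/2"
    "w \<bullet> lft w = 1/2" "w \<bullet> rgt w = 1/2"
proof -
  have w: "w \<bullet> w = 1" using assms by (simp add: norm_eq_1)
  then have w2: "w$1 * w$1 + w$2 * w$2 = 1" by (simp add: inner_vec_def sum_2)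
  have "lft w \<bullet> lft w = w$1 * w$1 + w$2 * w$2"
    by (simp add: inner_vec_def sum_2 lft_def field_simps)
  then show l: "lft w \<bullet> lft w = 1" using w2 by simp
  have "w \<bullet> lft w = (w$1 * w$1 + w$2 * w$2) / 2"
    by (simp add: inner_vec_def sum_2 lft_def field_simps)
  then show wl: "w \<bullet> lft w = 1/2" using w2 by simp
  then have lw: "lft w \<bullet> w = 1/2" by (simp add: inner_commute)
  show "rgt w \<bullet> rgt w = 1" "lft w \<bullet> rgt w = - 1/2" "rgt w \<bullet> lft w = - 1/2" "w \<bullet> rgt w = 1/2"
    using l wl lw w by (simp_all add: rgt_def inner_diff_left inner_diff_right)
qed

lemma norm_lft_rgt: "norm w = 1 \<Longrightarrow> norm (lft w) = 1" "norm w = 1 \<Longrightarrow> norm (rgt w) = 1"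
  by (simp_all add: norm_eq_1 inner_lft_rgt)

section \<open>Lower bounds at one branching point\<close>

lemma neg_inner_le_dist:
  fixes w :: point assumes "norm w = 1"
  shows "- (w \<bullet> (y - z)) \<le> dist y z"
  using Cauchy_Schwarz_ineq2[of w "y - z"] assms by (simp add: dist_norm)

text \<open>The two directions differ by a vector of length \<open>sqrt 3\<close>, which exceeds
  1.73.\<close>

lemma dist_lft_rgt:
  fixes w :: point assumes "norm w = 1" "0 \<le> r"
  shows "173/100 * r \<le> dist (x + r *\<^sub>R lft w) (x + r *\<^sub>R rgt w)"
proof -
  have "(norm (lft w - rgt w))\<^sup>2 = 3"
    using inner_lft_rgt[OF assms(1)]
    by (simp add: power2_norm_eq_inner inner_diff_left inner_diff_right)
  then have "(173/100)\<^sup>2 \<le> (norm (lft w - rgt w))\<^sup>2" by (simp add: power2_eq_square)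
  then have "173/100 \<le> norm (lft w - rgt w)" by (rule power2_le_imp_le) simp
  then have "173/100 * r \<le> norm (lft w - rgt w) * r" using assms(2) by (rule mult_right_mono)
  also have "\<dots> = dist (x + r *\<^sub>R lft w) (x + r *\<^sub>R rgt w)"
    using assms(2) by (simp add: dist_norm flip: scaleR_diff_right)
  finally show ?thesis .
qed

text \<open>For connecting \<open>v\<close> with all leaves below the branching point
  \<open>x\<close>; \<open>r\<close> is the length of the edges to the children, \<open>l\<close>
  the length of the tree below \<open>x\<close> and \<open>w\<close> the direction of arrival. The
  linear term is Maxwell's formula; the distance term takes over far away.\<close>

definition whole_bound :: "real \<Rightarrow> real \<Rightarrow> point \<Rightarrow> point \<Rightarrow> point \<Rightarrow> real" where
  "whole_bound l r x w v = max (l - w \<bullet> (v - x)) (max 0 (dist v x - 2 * r))"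

text \<open>For connecting \<open>v\<close> with some, but not all, leaves, at least one below each
  child. The distances to both children enter with an error of \<open>r / 100\<close> each, so
  \<open>2 - 2/100 = 99/50\<close> remains in the linear term, and 1.7 lies below
  \<open>1.73 - 2/100\<close>.\<close>

definition part_bound :: "real \<Rightarrow> point \<Rightarrow> point \<Rightarrow> point \<Rightarrow> real" where
  "part_bound r x w v = max (17/10 * r) (max (99/50 * r - w \<bullet> (v - x)) (dist v x - 2 * r))"

lemma bounds_nonneg: "0 \<le> whole_bound l r x w v" "0 \<le> r \<Longrightarrow> 0 \<le> part_bound r x w v"
  by (auto simp: whole_bound_def part_bound_def le_max_iff_disj)

lemma bounds_lower: "dist v x - 2 * r \<le> whole_bound l r x w v" "dist v x - 2 * r \<le> part_bound r x w v"
  by (auto simp: whole_bound_def part_bound_def)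

lemma bounds_lipschitz:
  assumes "norm w = 1"
  shows "whole_bound l r x w v \<le> whole_bound l r x w v' + dist v v'"
    and "part_bound r x w v \<le> part_bound r x w v' + dist v v'"
proof -
  have w: "- (w \<bullet> (v - x)) \<le> - (w \<bullet> (v' - x)) + dist v v'"
    using neg_inner_le_dist[OF assms, of v v'] by (simp add: inner_diff_right)
  have d: "dist v x \<le> dist v' x + dist v v'" using dist_triangle[of v x v'] by simp
  show "whole_bound l r x w v \<le> whole_bound l r x w v' + dist v v'"
    unfolding whole_bound_def using w d zero_le_dist[of v v'] by linarith
  show "part_bound r x w v \<le> part_bound r x w v' + dist v v'"
    unfolding part_bound_def using w d zero_le_dist[of v v'] by linarith
qed

text \<open>As \<open>lft w + rgt w = w\<close>, the linear functions of the children add up to that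
  of the parent; moving their base points to \<open>x\<close> contributes the two edges,
  \<open>2 * r\<close>.\<close>

lemma whole_bound_le:
  assumes w: "norm w = 1" and r: "0 \<le> r"
    and A: "l - lft w \<bullet> (v - (x + r *\<^sub>R lft w)) \<le> p" "dist v (x + r *\<^sub>R lft w) - r / 100 \<le> p" "0 \<le> p"
    and B: "l' - rgt w \<bullet> (v - (x + r *\<^sub>R rgt w)) \<le> q" "0 \<le> q"
  shows "whole_bound (2 * r + l + l') r x w v \<le> p + q"
proof -
  have "lft w \<bullet> (v - (x + r *\<^sub>R lft w)) + rgt w \<bullet> (v - (x + r *\<^sub>R rgt w)) = (lft w + rgt w) \<bullet> (v - x) - 2 * r"
    using inner_lft_rgt[OF w] by (simp add: inner_diff_right inner_add_right inner_add_left)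
  moreover have "dist v x \<le> dist v (x + r *\<^sub>R lft w) + r"
    using dist_triangle[of v x "x + r *\<^sub>R lft w"] norm_lft_rgt[OF w] r by (simp add: dist_norm)
  ultimately show ?thesis using A B r unfolding whole_bound_def lft_rgt by linarith
qed

lemma part_bound_le:
  assumes w: "norm w = 1" and r: "0 \<le> r"
    and A: "dist v (x + r *\<^sub>R lft w) - r / 100 \<le> p" "0 \<le> p"
    and B: "dist v (x + r *\<^sub>R rgt w) - r / 100 \<le> q" "0 \<le> q"
  shows "part_bound r x w v \<le> p + q"
proof -
  have "lft w \<bullet> (v - (x + r *\<^sub>R lft w)) + rgt w \<bullet> (v - (x + r *\<^sub>R rgt w)) = (lft w + rgt w) \<bullet> (v - x) - 2 * r"
    using inner_lft_rgt[OF w] by (simp add: inner_diff_right inner_add_right inner_add_left)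
  moreover have "dist v x \<le> dist v (x + r *\<^sub>R lft w) + r"
    using dist_triangle[of v x "x + r *\<^sub>R lft w"] norm_lft_rgt[OF w] r by (simp add: dist_norm)
  moreover have "173/100 * r \<le> dist v (x + r *\<^sub>R lft w) + dist v (x + r *\<^sub>R rgt w)"
    using dist_lft_rgt[OF w r, of x] dist_triangle2[of "x + r *\<^sub>R lft w" "x + r *\<^sub>R rgt w" v]
    by (simp add: dist_commute)
  ultimately show ?thesis
    using A B r neg_inner_le_dist[OF norm_lft_rgt(1)[OF w], of v "x + r *\<^sub>R lft w"]
      neg_inner_le_dist[OF norm_lft_rgt(2)[OF w], of v "x + r *\<^sub>R rgt w"]
    unfolding part_bound_def lft_rgt by linarith
qed

text \<open>
  The constant 1.7 works because a Steiner tree of the two children passing through one of them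
  has length at least \<open>sqrt 3 * r\<close>, whereas the linear function in \<^const>\<open>whole_bound\<close> is only
  about \<open>3/2 * r\<close> near a child.
\<close>

lemma whole_bound_le_part_bound:
  assumes w: "norm w = 1" and r: "0 \<le> r" and l: "l \<le> 203/100 * r" and p: "0 \<le> p"
    and u: "17/10 * r \<le> p \<or> (w \<bullet> u = 1/2 \<and> dist v (x + r *\<^sub>R u) - r / 100 \<le> p)"
  shows "whole_bound l r x w v \<le> part_bound r x w v + p"
proof -
  have "w \<bullet> (v - (x + r *\<^sub>R u)) = w \<bullet> (v - x) - r / 2" if "w \<bullet> u = 1/2"
    using that by (simp add: inner_diff_right inner_add_right)
  then show ?thesis
    using u r l p neg_inner_le_dist[OF w, of v "x + r *\<^sub>R u"] unfolding whole_bound_def part_bound_def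
    by linarith
qed

text \<open>With the factor 200, a branch, which extends at most twice its own scale from its root,
  is no larger than one hundredth of the edge leading to it.\<close>

locale scales =
  fixes R :: "nat \<Rightarrow> real"
  assumes R_ge_1: "1 \<le> R h" and R_gap: "200 * R h \<le> R (Suc h)"
begin

text \<open>
  The node \<open>rt t\<close> is placed at \<open>x\<close>, where \<open>w\<close> is the direction of the edge from its parent.  Edges
  at level \<open>h\<close> have length \<open>R h\<close>; the truncated \<open>h - 1\<close> is harmless as long as \<open>height t \<le> h\<close>.
\<close>

primrec place :: "'a bt \<Rightarrow> nat \<Rightarrow> point \<Rightarrow> point \<Rightarrow> 'a \<Rightarrow> point" where
  "place (Leaf a) h x w b = x"
| "place (Node s A B) h x w b =
    (if b = s then x
     else if b \<in> set_bt A then place A (h - 1) (x + R h *\<^sub>R lft w) (lft w) b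
     else place B (h - 1) (x + R h *\<^sub>R rgt w) (rgt w) b)"

primrec len :: "'a bt \<Rightarrow> nat \<Rightarrow> real" where
  "len (Leaf a) h = 0"
| "len (Node s A B) h = 2 * R h + len A (h - 1) + len B (h - 1)"

lemma place_rt [simp]: "place t h x w (rt t) = x"
  by (cases t) auto

lemma place_child:
  assumes "distinct_bt (Node s A B)"
  shows "b \<in> set_bt A \<Longrightarrow> place (Node s A B) h x w b = place A (h - 1) (x + R h *\<^sub>R lft w) (lft w) b"
    and "b \<in> set_bt B \<Longrightarrow> place (Node s A B) h x w b = place B (h - 1) (x + R h *\<^sub>R rgt w) (rgt w) b"
    and "place (Node s A B) h x w s = x"
  using assms by auto

lemma place_near:
  assumes "height t \<le> h" "norm w = 1" "b \<in> set_bt t"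
  shows "dist (place t h x w b) x \<le> 2 * R h"
  using assms
proof (induction t arbitrary: h x w)
  case (Leaf a)
  then show ?case using R_ge_1[of h] by simp
next
  case (Node s A B)
  obtain k where h: "h = Suc k" "height A \<le> k" "height B \<le> k"
    using Node.prems(1) by (cases h) auto
  have gap: "200 * R k \<le> R h" "1 \<le> R k" using R_gap[of k] R_ge_1[of k] h by auto
  have n: "norm (lft w) = 1" "norm (rgt w) = 1" using norm_lft_rgt Node.prems(2) by auto
  have "dist (place A k y (lft w) b) x \<le> 2 * R h" if "y = x + R h *\<^sub>R lft w" "b \<in> set_bt A" for y
    using Node.IH(1)[OF h(2) n(1) that(2), of y] dist_triangle[of "place A k y (lft w) b" x y] gap n that(1)
    by (simp add: dist_norm)
  moreover have "dist (place B k y (rgt w) b) x \<le> 2 * R h" if "y = x + R h *\<^sub>R rgt w" "b \<in> set_bt B" for y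
    using Node.IH(2)[OF h(3) n(2) that(2), of y] dist_triangle[of "place B k y (rgt w) b" x y] gap n that(1)
    by (simp add: dist_norm)
  ultimately show ?case using Node.prems(3) gap h(1) by auto
qed

text \<open>The two branches lie in small discs around points at distance at least
  \<open>1.73 * R h\<close>. A definite distance, stronger than injectivity, keeps the nodes
  distinct when the Steiner points are moved slightly.\<close>

lemma place_separated:
  assumes "height t \<le> h" "norm w = 1" "distinct_bt t" "b \<in> set_bt t" "c \<in> set_bt t" "b \<noteq> c"
  shows "1/2 \<le> dist (place t h x w b) (place t h x w c)"
  using assms
proof (induction t arbitrary: h x w b c)
  case (Leaf a)
  then show ?case by simp
next
  case (Node s A B)
  obtain k where h: "h = Suc k" "height A \<le> k" "height B \<le> k"
    using Node.prems(1) by (cases h) auto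
  have gap: "200 * R k \<le> R h" "1 \<le> R k" using R_gap[of k] R_ge_1[of k] h by auto
  have n: "norm (lft w) = 1" "norm (rgt w) = 1" using norm_lft_rgt Node.prems(2) by auto
  let ?p = "place (Node s A B) h x w" and ?a = "x + R h *\<^sub>R lft w" and ?b = "x + R h *\<^sub>R rgt w"
  note pc = place_child[OF Node.prems(3), where h = h and x = x and w = w, unfolded h(1) diff_Suc_1, folded h(1)]
  have dA: "distinct_bt A" and dB: "distinct_bt B" using Node.prems(3) by auto
  have nA: "dist (?p b) ?a \<le> 2 * R k" if "b \<in> set_bt A" for b
    using place_near[OF h(2) n(1) that] pc(1)[OF that] by simp
  have nB: "dist (?p b) ?b \<le> 2 * R k" if "b \<in> set_bt B" for b
    using place_near[OF h(3) n(2) that] pc(2)[OF that] by simp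
  have ab: "dist x ?a = R h" "dist x ?b = R h" using n gap by (simp_all add: dist_norm)
  have sAB: "1/2 \<le> dist (?p s) (?p b)" if "b \<in> set_bt A \<or> b \<in> set_bt B" for b
    using that
  proof
    assume "b \<in> set_bt A"
    then show ?thesis using nA[of b] ab gap dist_triangle[of x ?a "?p b"] unfolding pc(3) by linarith
  next
    assume "b \<in> set_bt B"
    then show ?thesis using nB[of b] ab gap dist_triangle[of x ?b "?p b"] unfolding pc(3) by linarith
  qed
  have cross: "1/2 \<le> dist (?p b) (?p c)" if "b \<in> set_bt A" "c \<in> set_bt B" for b c
    using nA[OF that(1)] nB[OF that(2)] dist_lft_rgt[OF Node.prems(2), of "R h" x] gap
      dist_triangle[of ?a ?b "?p b"] dist_triangle[of "?p b" ?b "?p c"] dist_commute[of ?a "?p b"]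
    by linarith
  consider "b = s" | "c = s" | "b \<in> set_bt A" "c \<in> set_bt A" | "b \<in> set_bt B" "c \<in> set_bt B"
    | "b \<in> set_bt A" "c \<in> set_bt B" | "b \<in> set_bt B" "c \<in> set_bt A"
    using Node.prems(4,5) by auto
  then show ?case
  proof cases
    case 1 then show ?thesis using sAB[of c] Node.prems(5,6) by auto
  next
    case 2 then show ?thesis using sAB[of b] Node.prems(4,6) by (auto simp: dist_commute)
  next
    case 3 then show ?thesis using Node.IH(1)[OF h(2) n(1) dA _ _ Node.prems(6), of ?a] pc(1) by simp
  next
    case 4 then show ?thesis using Node.IH(2)[OF h(3) n(2) dB _ _ Node.prems(6), of ?b] pc(2) by simp
  next
    case 5 then show ?thesis by (rule cross)
  next
    case 6 then show ?thesis using cross[of c b] by (simp add: dist_commute)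
  qed
qed

lemma place_image_child:
  assumes "distinct_bt (Node s A B)"
  shows "e \<in> bt_edges A \<Longrightarrow> place (Node s A B) h x w ` e = place A (h - 1) (x + R h *\<^sub>R lft w) (lft w) ` e"
    and "e \<in> bt_edges B \<Longrightarrow> place (Node s A B) h x w ` e = place B (h - 1) (x + R h *\<^sub>R rgt w) (rgt w) ` e"
  by (rule image_cong[OF refl], rule place_child[OF assms], erule subsetD[OF bt_edges_subset, rotated], assumption)+

lemma place_root_edges:
  assumes "distinct_bt (Node s A B)" "norm w = 1"
  shows "diameter (place (Node s A B) h x w ` {s, rt A}) = R h"
    and "diameter (place (Node s A B) h x w ` {s, rt B}) = R h"
  using place_child[OF assms(1), where h = h and x = x and w = w] norm_lft_rgt[OF assms(2)] R_ge_1[of h]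
  by (simp_all add: diameter_doubleton dist_norm del: place.simps)

lemma place_edge_length:
  assumes "distinct_bt t" "norm w = 1" "e \<in> bt_edges t"
  shows "\<exists>j. diameter (place t h x w ` e) = R j"
  using assms
proof (induction t arbitrary: h x w)
  case (Node s A B)
  have n: "norm (lft w) = 1" "norm (rgt w) = 1" "distinct_bt A" "distinct_bt B"
    using norm_lft_rgt Node.prems by auto
  consider "e = {s, rt A} \<or> e = {s, rt B}" | "e \<in> bt_edges A" | "e \<in> bt_edges B"
    using Node.prems(3) by auto
  then show ?case
  proof cases
    case 1 then show ?thesis using place_root_edges[OF Node.prems(1,2)] by blast
  next
    case 2 then show ?thesis using Node.IH(1)[OF n(3,1)] place_image_child(1)[OF Node.prems(1)] by metis
  next
    case 3 then show ?thesis using Node.IH(2)[OF n(4,2)] place_image_child(2)[OF Node.prems(1)] by metis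
  qed
qed simp

lemma sum_place_edges:
  assumes "distinct_bt t" "norm w = 1"
  shows "(\<Sum>e\<in>bt_edges t. diameter (place t h x w ` e)) = len t h"
  using assms
proof (induction t arbitrary: h x w)
  case (Node s A B)
  have n: "norm (lft w) = 1" "norm (rgt w) = 1" "distinct_bt A" "distinct_bt B"
    using norm_lft_rgt Node.prems by auto
  show ?case
    unfolding sum_bt_edges_Node[OF Node.prems(1)] place_root_edges[OF Node.prems]
    using Node.IH(1)[OF n(3,1)] Node.IH(2)[OF n(4,2)]
    by (simp add: place_image_child[OF Node.prems(1)] del: place.simps)
qed simp

lemma len_le: "height t \<le> h \<Longrightarrow> len t h \<le> 3 * R h"
proof (induction t arbitrary: h)
  case (Leaf a)
  then show ?case using R_ge_1[of h] by simp
next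
  case (Node s A B)
  obtain k where h: "h = Suc k" "height A \<le> k" "height B \<le> k"
    using Node.prems(1) by (cases h) auto
  show ?case using Node.IH(1)[OF h(2)] Node.IH(2)[OF h(3)] R_gap[of k] R_ge_1[of k] h(1) by simp
qed

section \<open>The dual certificate for minimal length\<close>

text \<open>
  \<open>psi t h x w D v\<close> is a lower bound for the length of a tree connecting \<open>v\<close> with the leaves of
  \<open>t\<close> in \<open>D\<close>.  For \<open>D\<close> containing all leaves it is exact along the edge that enters the root
  position \<open>x\<close> in direction \<open>w\<close>, where it is the linear function of Maxwell's formula.  All other
  estimates carry a slack of the order of the next smaller scale, which the geometric gap
  between the scales absorbs.
\<close>

primrec psi :: "'a bt \<Rightarrow> nat \<Rightarrow> point \<Rightarrow> point \<Rightarrow> 'a set \<Rightarrow> point \<Rightarrow> real" where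
  "psi (Leaf a) h x w D v = (if a \<in> D then dist v x else 0)"
| "psi (Node s A B) h x w D v =
    (if leaves A \<inter> D = {} then psi B (h - 1) (x + R h *\<^sub>R rgt w) (rgt w) D v
     else if leaves B \<inter> D = {} then psi A (h - 1) (x + R h *\<^sub>R lft w) (lft w) D v
     else if leaves A \<union> leaves B \<subseteq> D
       then whole_bound (len (Node s A B) h) (R h) x w v
     else part_bound (R h) x w v)"

lemma psi_nonneg: "0 \<le> psi t h x w D v"
proof (induction t arbitrary: h x w)
  case (Node s A B)
  then show ?case using R_ge_1[of h] by (simp add: bounds_nonneg)
qed simp

lemma psi_empty: "leaves t \<inter> D = {} \<Longrightarrow> psi t h x w D v = 0"
  by (induction t arbitrary: h x w) (auto simp: Int_Un_distrib2)

lemma psi_cong: "leaves t \<inter> D = leaves t \<inter> D' \<Longrightarrow> psi t h x w D v = psi t h x w D' v"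
proof (induction t arbitrary: h x w)
  case (Leaf a)
  then show ?case by auto
next
  case (Node s A B)
  have "leaves A \<inter> D = leaves A \<inter> D'" "leaves B \<inter> D = leaves B \<inter> D'" using Node.prems by auto
  moreover have "leaves A \<union> leaves B \<subseteq> D \<longleftrightarrow> leaves A \<union> leaves B \<subseteq> D'" using Node.prems by auto
  ultimately show ?case using Node.IH by simp
qed

lemma psi_lipschitz:
  assumes "norm w = 1"
  shows "psi t h x w D v \<le> psi t h x w D v' + dist v v'"
  using assms
proof (induction t arbitrary: h x w)
  case (Leaf a)
  then show ?case by (auto simp: dist_triangle add.commute)
next
  case (Node s A B)
  have n: "norm (lft w) = 1" "norm (rgt w) = 1" using norm_lft_rgt Node.prems by auto
  show ?case using Node.IH n bounds_lipschitz[OF Node.prems] by simp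
qed

text \<open>All leaves of \<open>t\<close> lie within \<open>2 * R h\<close> of \<open>x\<close>,
  and at least one has to be reached. For the branch at a child this error is at most one hundredth
  of the edge above it.\<close>

lemma psi_lower:
  assumes "height t \<le> h" "norm w = 1" "leaves t \<inter> D \<noteq> {}"
  shows "dist v x - 2 * R h \<le> psi t h x w D v"
  using assms
proof (induction t arbitrary: h x w)
  case (Leaf a)
  then show ?case using R_ge_1[of h] by auto
next
  case (Node s A B)
  obtain k where h: "h = Suc k" "height A \<le> k" "height B \<le> k"
    using Node.prems(1) by (cases h) auto
  have gap: "200 * R k \<le> R h" "1 \<le> R k" using R_gap[of k] R_ge_1[of k] h by auto
  have n: "norm (lft w) = 1" "norm (rgt w) = 1" using norm_lft_rgt Node.prems(2) by auto
  have d: "dist v x \<le> dist v (x + R h *\<^sub>R lft w) + R h" "dist v x \<le> dist v (x + R h *\<^sub>R rgt w) + R h"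
    using dist_triangle[of v x "x + R h *\<^sub>R lft w"] dist_triangle[of v x "x + R h *\<^sub>R rgt w"] n gap
    by (simp_all add: dist_norm)
  consider "leaves A \<inter> D = {}" "leaves B \<inter> D \<noteq> {}" | "leaves A \<inter> D \<noteq> {}" "leaves B \<inter> D = {}"
    | "leaves A \<inter> D \<noteq> {}" "leaves B \<inter> D \<noteq> {}"
    using Node.prems(3) by auto
  then show ?case
  proof cases
    case 1
    then show ?thesis using Node.IH(2)[OF h(3) n(2), of "x + R h *\<^sub>R rgt w"] d gap h(1) by simp
  next
    case 2
    then show ?thesis using Node.IH(1)[OF h(2) n(1), of "x + R h *\<^sub>R lft w"] d gap h(1) by simp
  next
    case 3
    then show ?thesis using bounds_lower[of v x "R h"] by simp
  qed
qed

text \<open>At a leaf the linear function lies below the distance by Cauchy-Schwarz; at an inner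
  node it is one of the terms of the maximum.\<close>

lemma psi_full: "norm w = 1 \<Longrightarrow> leaves t \<subseteq> D \<Longrightarrow> len t h - w \<bullet> (v - x) \<le> psi t h x w D v"
  using neg_inner_le_dist[of w v x] by (cases t) (auto simp: Int_absorb2 whole_bound_def)

lemma psi_at_leaf:
  assumes "distinct_bt t" "a \<in> leaves t"
  shows "psi t h x w {a} (place t h x w a) = 0"
  using assms
proof (induction t arbitrary: h x w)
  case (Node s A B)
  have a: "a \<in> set_bt A \<and> a \<notin> leaves B \<and> a \<in> leaves A \<or> a \<in> set_bt B \<and> a \<notin> leaves A \<and> a \<in> leaves B"
    using Node.prems leaves_subset[of A] leaves_subset[of B] by auto
  then show ?case using Node.IH place_child[OF Node.prems(1)] Node.prems by auto
qed simp

text \<open>The cases are the ways in which \<open>D\<close> and \<open>D'\<close> meet the two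
  branches. If only one branch is met, the induction hypothesis applies; if each set has its own
  branch, the bounds of the children add up; if one set meets both branches and the other meets at
  least one, the former is measured by \<open>part_bound\<close>.\<close>

lemma psi_subadditive:
  assumes "D \<inter> D' = {}" "height t \<le> h" "norm w = 1"
  shows "psi t h x w (D \<union> D') v \<le> psi t h x w D v + psi t h x w D' v"
  using assms
proof (induction t arbitrary: h x w)
  case (Leaf a)
  then show ?case by auto
next
  case (Node s A B)
  obtain k where h: "h = Suc k" "height A \<le> k" "height B \<le> k"
    using Node.prems(2) by (cases h) auto
  have gap: "200 * R k \<le> R h" "1 \<le> R k" "0 \<le> R h" using R_gap[of k] R_ge_1[of k] R_ge_1[of h] h by auto
  have n: "norm (lft w) = 1" "norm (rgt w) = 1" using norm_lft_rgt Node.prems(3) by auto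
  let ?a = "x + R h *\<^sub>R lft w" and ?b = "x + R h *\<^sub>R rgt w"
  define f where "f E = psi (Node s A B) h x w E v" for E
  define fA where "fA E = psi A k ?a (lft w) E v" for E
  define fB where "fB E = psi B k ?b (rgt w) E v" for E
  note defs = f_def fA_def fB_def
  have nonneg: "0 \<le> f E" "0 \<le> fA E" "0 \<le> fB E" for E by (simp_all add: defs psi_nonneg del: psi.simps)
  have fA: "f E = fA E" if "leaves B \<inter> E = {}" for E
    using that by (simp add: defs h(1) psi_empty)
  have fB: "f E = fB E" if "leaves A \<inter> E = {}" for E
    using that by (simp add: defs h(1))
  have whole: "f E = whole_bound (2 * R h + len A k + len B k) (R h) x w v" if "leaves A \<union> leaves B \<subseteq> E" for E
    using that by (simp add: defs h(1) Int_absorb2)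
  have part: "f E = part_bound (R h) x w v"
    if "leaves A \<inter> E \<noteq> {}" "leaves B \<inter> E \<noteq> {}" "\<not> leaves A \<union> leaves B \<subseteq> E" for E
    using that by (simp add: defs h(1)) blast
  have lowA: "dist v ?a - R h / 100 \<le> fA E" if "leaves A \<inter> E \<noteq> {}" for E
    using psi_lower[OF h(2) n(1) that, of v ?a] gap by (simp add: defs)
  have lowB: "dist v ?b - R h / 100 \<le> fB E" if "leaves B \<inter> E \<noteq> {}" for E
    using psi_lower[OF h(3) n(2) that, of v ?b] gap by (simp add: defs)
  \<comment> \<open>Each branch has length at most \<open>3 * R k\<close>, hence at most
    \<open>3/200 * R h\<close>.\<close>
  have len: "2 * R h + len A k + len B k \<le> 203/100 * R h"
    using len_le[OF h(2)] len_le[OF h(3)] gap by simp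
  have split: "f (E \<union> E') \<le> f E + f E'"
    if E: "leaves A \<inter> E \<noteq> {}" "leaves B \<inter> E = {}" "leaves A \<inter> E' = {}" "leaves B \<inter> E' \<noteq> {}" for E E'
  proof (cases "leaves A \<union> leaves B \<subseteq> E \<union> E'")
    case True
    then have "leaves A \<subseteq> E" "leaves B \<subseteq> E'" using E by auto
    then have "len A k - lft w \<bullet> (v - ?a) \<le> fA E" "len B k - rgt w \<bullet> (v - ?b) \<le> fB E'"
      using psi_full n by (auto simp: defs)
    from whole_bound_le[OF Node.prems(3) gap(3) this(1) lowA[OF E(1)] nonneg(2) this(2) nonneg(3)]
    show ?thesis using whole[OF True] fA[OF E(2)] fB[OF E(3)] by simp
  next
    case False
    have "f (E \<union> E') = part_bound (R h) x w v" using E False by (intro part) auto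
    then show ?thesis
      using part_bound_le[OF Node.prems(3) gap(3) lowA[OF E(1)] nonneg(2) lowB[OF E(4)] nonneg(3)]
        fA[OF E(2)] fB[OF E(3)] by simp
  qed
  \<comment> \<open>\<open>E'\<close> takes some leaf away from \<open>E\<close>, so
    \<open>f E\<close> is a \<open>part_bound\<close>. The value changes its form only if the union
    is complete, and then \<open>f E'\<close> has to cover the difference.\<close>
  have both: "f (E \<union> E') \<le> f E + f E'"
    if E: "leaves A \<inter> E \<noteq> {}" "leaves B \<inter> E \<noteq> {}" "(leaves A \<union> leaves B) \<inter> E' \<noteq> {}" "E \<inter> E' = {}" for E E'
  proof -
    have fE: "f E = part_bound (R h) x w v" using E by (intro part) auto
    show ?thesis
    proof (cases "leaves A \<union> leaves B \<subseteq> E \<union> E'")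
      case False
      then have "f (E \<union> E') = part_bound (R h) x w v" using E by (intro part) auto
      then show ?thesis using fE nonneg(1)[of E'] by simp
    next
      case True
      consider "leaves B \<inter> E' = {}" "leaves A \<inter> E' \<noteq> {}" | "leaves A \<inter> E' = {}" "leaves B \<inter> E' \<noteq> {}"
        | "leaves A \<inter> E' \<noteq> {}" "leaves B \<inter> E' \<noteq> {}" using E(3) by auto
      \<comment> \<open>If \<open>E'\<close> meets only one branch, \<open>u\<close> is the
        direction of that child; otherwise \<open>f E'\<close> is itself a \<open>part_bound\<close>
        and at least its constant term.\<close>
      then have "17/10 * R h \<le> f E' \<or> (\<exists>u. w \<bullet> u = 1/2 \<and> dist v (x + R h *\<^sub>R u) - R h / 100 \<le> f E')"
      proof cases
        case 1
        then show ?thesis using lowA[of E'] fA[of E'] inner_lft_rgt[OF Node.prems(3)] by auto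
      next
        case 2
        then show ?thesis using lowB[of E'] fB[of E'] inner_lft_rgt[OF Node.prems(3)] by auto
      next
        case 3
        then have "f E' = part_bound (R h) x w v" using E by (intro part) auto
        then show ?thesis by (simp add: part_bound_def)
      qed
      then obtain u where "17/10 * R h \<le> f E' \<or> (w \<bullet> u = 1/2 \<and> dist v (x + R h *\<^sub>R u) - R h / 100 \<le> f E')"
        by blast
      from whole_bound_le_part_bound[OF Node.prems(3) gap(3) len nonneg(1) this]
      show ?thesis unfolding whole[OF True] fE .
    qed
  qed
  have IH: "fA (D \<union> D') \<le> fA D + fA D'" "fB (D \<union> D') \<le> fB D + fB D'"
    unfolding defs
    by (rule Node.IH(1)[OF Node.prems(1) h(2) n(1)], rule Node.IH(2)[OF Node.prems(1) h(3) n(2)])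
  have "f (D \<union> D') \<le> f D + f D'"
  proof -
    \<comment> \<open>These cases cover all sixteen patterns of empty intersections.\<close>
    consider "leaves A \<inter> (D \<union> D') = {}" | "leaves B \<inter> (D \<union> D') = {}"
      | "(leaves A \<union> leaves B) \<inter> D = {}" | "(leaves A \<union> leaves B) \<inter> D' = {}"
      | "leaves A \<inter> D \<noteq> {}" "leaves B \<inter> D = {}" "leaves A \<inter> D' = {}" "leaves B \<inter> D' \<noteq> {}"
      | "leaves A \<inter> D' \<noteq> {}" "leaves B \<inter> D' = {}" "leaves A \<inter> D = {}" "leaves B \<inter> D \<noteq> {}"
      | "leaves A \<inter> D \<noteq> {}" "leaves B \<inter> D \<noteq> {}" "(leaves A \<union> leaves B) \<inter> D' \<noteq> {}"
      | "leaves A \<inter> D' \<noteq> {}" "leaves B \<inter> D' \<noteq> {}" "(leaves A \<union> leaves B) \<inter> D \<noteq> {}"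
      by (cases "leaves A \<inter> D = {}"; cases "leaves B \<inter> D = {}"; cases "leaves A \<inter> D' = {}";
          cases "leaves B \<inter> D' = {}") (simp_all add: Int_Un_distrib Int_Un_distrib2)
    then show ?thesis
    proof cases
      case 1
      then have "leaves A \<inter> D = {}" "leaves A \<inter> D' = {}" by auto
      then show ?thesis using IH(2) by (simp only: fB fB[OF 1])
    next
      case 2
      then have "leaves B \<inter> D = {}" "leaves B \<inter> D' = {}" by auto
      then show ?thesis using IH(1) by (simp only: fA fA[OF 2])
    next
      case 3
      then have "f (D \<union> D') = f D'" unfolding f_def by (intro psi_cong) auto
      then show ?thesis using nonneg(1)[of D] by simp
    next
      case 4
      then have "f (D \<union> D') = f D" unfolding f_def by (intro psi_cong) auto
      then show ?thesis using nonneg(1)[of D'] by simp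
    next
      case 5 then show ?thesis by (rule split)
    next
      case 6 then show ?thesis using split[of D' D] by (simp add: Un_commute)
    next
      case 7 then show ?thesis using both[of D D'] Node.prems(1) by simp
    next
      case 8 then show ?thesis using both[of D' D] Node.prems(1) by (simp add: Un_commute Int_commute)
    qed
  qed
  then show ?case unfolding f_def .
qed

text \<open>A join splits the leaves reached into two disjoint sets, to which subadditivity applies,
  and the Lipschitz bound pays for the new edge. At a single node separation leaves at most one
  leaf, where \<open>psi\<close> vanishes.\<close>

lemma rooted_length_ge:
  assumes t: "height t \<le> h" "norm w = 1" "distinct_bt t" and E: "rooted r V E"
  shows "psi t h x w {a \<in> leaves t. place t h x w a \<in> V} r \<le> (\<Sum>e\<in>E. diameter e)"
  using E
proof (induction rule: rooted.induct)
  case (single r)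
  show ?case
  proof (cases "\<exists>a\<in>leaves t. place t h x w a = r")
    case True
    then obtain a where a: "a \<in> leaves t" "place t h x w a = r" by blast
    have "b = a" if "b \<in> leaves t" "place t h x w b = r" for b
    proof (rule ccontr)
      assume "b \<noteq> a"
      moreover have "b \<in> set_bt t" "a \<in> set_bt t" using a that leaves_subset[of t] by auto
      ultimately have "1/2 \<le> dist (place t h x w b) (place t h x w a)" by (intro place_separated[OF t])
      then show False using a that by simp
    qed
    then have "{b \<in> leaves t. place t h x w b \<in> {r}} = {a}" using a by blast
    then show ?thesis using psi_at_leaf[OF t(3) a(1), of h x w] a(2) by simp
  next
    case False
    then have "leaves t \<inter> {a \<in> leaves t. place t h x w a \<in> {r}} = {}" by auto
    from psi_empty[OF this] show ?thesis by simp
  qed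
next
  case (join r V E s W F)
  let ?D = "\<lambda>V. {a \<in> leaves t. place t h x w a \<in> V}"
  note V = rooted_finite[OF join.hyps(1)] and W = rooted_finite[OF join.hyps(2)]
  have "e \<notin> F" if e: "e \<in> E" for e
  proof
    assume "e \<in> F"
    then have "e \<subseteq> V \<inter> W" using e V W by auto
    then show False using rooted_nonempty[OF join.hyps(1) e] join.hyps(3) by simp
  qed
  then have "E \<inter> F = {}" by auto
  moreover have "{r, s} \<notin> E \<union> F"
  proof
    assume "{r, s} \<in> E \<union> F"
    then have "s \<in> V \<or> r \<in> W" using V W by blast
    then show False using V W join.hyps(3) by blast
  qed
  ultimately have sum: "(\<Sum>e\<in>insert {r, s} (E \<union> F). diameter e) =
      dist r s + ((\<Sum>e\<in>E. diameter e) + (\<Sum>e\<in>F. diameter e))"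
    using V W by (simp add: sum.union_disjoint diameter_doubleton)
  have D: "?D (V \<union> W) = ?D V \<union> ?D W" "?D V \<inter> ?D W = {}" using join.hyps(3) by auto
  have "psi t h x w (?D (V \<union> W)) r \<le> psi t h x w (?D V) r + psi t h x w (?D W) r"
    unfolding D(1) by (rule psi_subadditive[OF D(2) t(1,2)])
  also have "psi t h x w (?D W) r \<le> psi t h x w (?D W) s + dist r s"
    by (rule psi_lipschitz[OF t(2)])
  finally show ?case using join.IH sum by linarith
qed

section \<open>First-order motion of the Steiner points\<close>

text \<open>
  The velocity \<open>v s\<close> of a Steiner point is determined from the leaves upwards: the two edges to its
  children have to shrink at unit rate, which are two independent linear equations.
\<close>

lemma velocities:
  assumes "distinct_bt t" "norm w = 1"
  shows "\<exists>v :: 'a \<Rightarrow> point. (\<forall>a\<in>leaves t. v a = 0) \<and>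
    (\<forall>b\<in>set_bt t. norm (v b) \<le> 2 * real (card (bt_edges t))) \<and> \<bar>w \<bullet> v (rt t)\<bar> \<le> card (bt_edges t) \<and>
    (\<forall>b c. {b, c} \<in> bt_edges t \<longrightarrow>
      (place t h x w b - place t h x w c) \<bullet> (v b - v c) = - dist (place t h x w b) (place t h x w c))"
  using assms
proof (induction t arbitrary: h x w)
  case (Leaf a)
  show ?case by (rule exI[of _ "\<lambda>_. 0"]) simp
next
  case (Node s A B)
  let ?a = "x + R h *\<^sub>R lft w" and ?b = "x + R h *\<^sub>R rgt w" and ?p = "place (Node s A B) h x w"
  have n: "norm (lft w) = 1" "norm (rgt w) = 1" "distinct_bt A" "distinct_bt B"
    using norm_lft_rgt Node.prems by auto
  have d: "s \<notin> set_bt A" "s \<notin> set_bt B" "set_bt A \<inter> set_bt B = {}" using Node.prems by auto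
  note ip = inner_lft_rgt[OF Node.prems(2)]
  note pc = place_child[OF Node.prems(1), where h = h and x = x and w = w]
  obtain vA where vA: "\<And>a. a \<in> leaves A \<Longrightarrow> vA a = 0"
    "\<And>b. b \<in> set_bt A \<Longrightarrow> norm (vA b) \<le> 2 * real (card (bt_edges A))"
    "\<bar>lft w \<bullet> vA (rt A)\<bar> \<le> card (bt_edges A)"
    "\<And>b c. {b, c} \<in> bt_edges A \<Longrightarrow> (place A (h - 1) ?a (lft w) b - place A (h - 1) ?a (lft w) c) \<bullet> (vA b - vA c)
      = - dist (place A (h - 1) ?a (lft w) b) (place A (h - 1) ?a (lft w) c)"
    using Node.IH(1)[OF n(3,1), of "h - 1" ?a] by metis
  obtain vB where vB: "\<And>a. a \<in> leaves B \<Longrightarrow> vB a = 0"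
    "\<And>b. b \<in> set_bt B \<Longrightarrow> norm (vB b) \<le> 2 * real (card (bt_edges B))"
    "\<bar>rgt w \<bullet> vB (rt B)\<bar> \<le> card (bt_edges B)"
    "\<And>b c. {b, c} \<in> bt_edges B \<Longrightarrow> (place B (h - 1) ?b (rgt w) b - place B (h - 1) ?b (rgt w) c) \<bullet> (vB b - vB c)
      = - dist (place B (h - 1) ?b (rgt w) b) (place B (h - 1) ?b (rgt w) c)"
    using Node.IH(2)[OF n(4,2), of "h - 1" ?b] by metis
  \<comment> \<open>The components that the velocity of \<open>s\<close> needs along the edges to
    its children: one more than the child's own component, so that the edge shrinks at unit
    rate.\<close>
  define p where "p = lft w \<bullet> vA (rt A) + 1"
  define q where "q = rgt w \<bullet> vB (rt B) + 1"
  \<comment> \<open>The solution of \<open>lft w \<bullet> u = p\<close> and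
    \<open>rgt w \<bullet> u = q\<close>, by inverting the Gram matrix with diagonal 1 and
    off-diagonal -1/2. Its component along \<open>w\<close> is \<open>p + q\<close>, so these
    components grow only additively up the tree, which makes the bounds linear in the number of
    edges.\<close>
  define u where "u = ((4 * p + 2 * q) / 3) *\<^sub>R lft w + ((4 * q + 2 * p) / 3) *\<^sub>R rgt w"
  have u: "lft w \<bullet> u = p" "rgt w \<bullet> u = q" "w \<bullet> u = p + q"
    by (simp_all add: u_def inner_add_right ip field_simps)
  define v where "v b = (if b = s then u else if b \<in> set_bt A then vA b else vB b)" for b
  have v: "v s = u" "\<And>b. b \<in> set_bt A \<Longrightarrow> v b = vA b" "\<And>b. b \<in> set_bt B \<Longrightarrow> v b = vB b"
    using d by (auto simp: v_def)
  have card: "card (bt_edges (Node s A B)) = 2 + card (bt_edges A) + card (bt_edges B)"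
    using sum_bt_edges_Node[OF Node.prems(1), of "\<lambda>_. 1::nat"] by simp
  have pq: "\<bar>p\<bar> + \<bar>q\<bar> \<le> card (bt_edges (Node s A B))"
    using vA(3) vB(3) unfolding p_def q_def card by simp
  have "norm u \<le> \<bar>(4 * p + 2 * q) / 3\<bar> + \<bar>(4 * q + 2 * p) / 3\<bar>"
    unfolding u_def by (rule order_trans[OF norm_triangle_ineq]) (simp add: n)
  also have "\<dots> \<le> 2 * (\<bar>p\<bar> + \<bar>q\<bar>)"
  proof -
    have "\<bar>4 * p + 2 * q\<bar> \<le> 4 * \<bar>p\<bar> + 2 * \<bar>q\<bar>" "\<bar>4 * q + 2 * p\<bar> \<le> 4 * \<bar>q\<bar> + 2 * \<bar>p\<bar>" by linarith+
    then show ?thesis by simp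
  qed
  finally have nu: "norm u \<le> 2 * real (card (bt_edges (Node s A B)))"
    by (rule order_trans[OF _ mult_left_mono[OF pq]]) simp
  have edge_A: "(?p s - ?p (rt A)) \<bullet> (v s - v (rt A)) = - dist (?p s) (?p (rt A))"
    using R_ge_1[of h] n v u(1) pc(1)[of "rt A"] pc(3)
    by (simp add: dist_norm inner_diff_right p_def algebra_simps del: place.simps)
  have edge_B: "(?p s - ?p (rt B)) \<bullet> (v s - v (rt B)) = - dist (?p s) (?p (rt B))"
    using R_ge_1[of h] n v u(2) pc(2)[of "rt B"] pc(3)
    by (simp add: dist_norm inner_diff_right q_def algebra_simps del: place.simps)
  have flip: "(?p c - ?p b) \<bullet> (v c - v b) = - dist (?p c) (?p b)"
    if "(?p b - ?p c) \<bullet> (v b - v c) = - dist (?p b) (?p c)" for b c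
    using that by (simp add: inner_diff_left inner_diff_right dist_commute algebra_simps)
  show ?case
  proof (intro exI[of _ v] conjI ballI allI impI)
    show "v a = 0" if "a \<in> leaves (Node s A B)" for a
      using that vA(1) vB(1) v(2,3) leaves_subset[of A] leaves_subset[of B] by auto
    show "norm (v b) \<le> 2 * real (card (bt_edges (Node s A B)))" if "b \<in> set_bt (Node s A B)" for b
      using that nu vA(2)[of b] vB(2)[of b] v unfolding card by auto
    show "\<bar>w \<bullet> v (rt (Node s A B))\<bar> \<le> card (bt_edges (Node s A B))"
      using pq u(3) v(1) by simp
    fix b c assume "{b, c} \<in> bt_edges (Node s A B)"
    then consider "b = s" "c = rt A" | "c = s" "b = rt A" | "b = s" "c = rt B" | "c = s" "b = rt B"
      | "{b, c} \<in> bt_edges A" | "{b, c} \<in> bt_edges B"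
      by (auto simp: doubleton_eq_iff)
    then show "(?p b - ?p c) \<bullet> (v b - v c) = - dist (?p b) (?p c)"
    proof cases
      case 1 then show ?thesis using edge_A by simp
    next
      case 2 then show ?thesis using flip[OF edge_A] by simp
    next
      case 3 then show ?thesis using edge_B by simp
    next
      case 4 then show ?thesis using flip[OF edge_B] by simp
    next
      case 5
      then have "b \<in> set_bt A" "c \<in> set_bt A" using bt_edges_subset[OF 5] by auto
      then show ?thesis using vA(4)[OF 5] pc(1) v(2) by (simp del: place.simps)
    next
      case 6
      then have "b \<in> set_bt B" "c \<in> set_bt B" using bt_edges_subset[OF 6] by auto
      then show ?thesis using vB(4)[OF 6] pc(2) v(3) by (simp del: place.simps)
    qed
  qed
qed

end

section \<open>Transport along an injective placement\<close>

definition map_graph :: "('a \<Rightarrow> 'b) \<Rightarrow> 'a ugraph \<Rightarrow> 'b ugraph" where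
  "map_graph f G = \<lparr>nodes = f ` nodes G, edges = (\<lambda>e. f ` e) ` edges G\<rparr>"

lemma simple_edge_subset: "simple_graph G \<Longrightarrow> e \<in> edges G \<Longrightarrow> e \<subseteq> nodes G"
  unfolding simple_graph_def by fastforce

lemma inj_on_image_edges:
  assumes "simple_graph G" "inj_on f (nodes G)"
  shows "inj_on (\<lambda>e. f ` e) (edges G)"
  using inj_on_image_eq_iff[OF assms(2)] simple_edge_subset[OF assms(1)] by (auto simp: inj_on_def)

lemma sum_edges_map_graph:
  assumes "simple_graph G" "inj_on f (nodes G)"
  shows "(\<Sum>e\<in>edges (map_graph f G). g e) = (\<Sum>e\<in>edges G. g (f ` e))"
  using inj_on_image_edges[OF assms] by (simp add: map_graph_def sum.reindex)

lemma node_degree_map_graph: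
  assumes "simple_graph G" "inj_on f (nodes G)" "v \<in> nodes G"
  shows "node_degree (map_graph f G) (f v) = node_degree G v"
proof -
  have "{e \<in> edges (map_graph f G). f v \<in> e} = (\<lambda>e. f ` e) ` {e \<in> edges G. v \<in> e}"
    using inj_on_image_mem_iff[OF assms(2,3)] simple_edge_subset[OF assms(1)] by (auto simp: map_graph_def)
  moreover have "inj_on (\<lambda>e. f ` e) {e \<in> edges G. v \<in> e}"
    by (rule inj_on_subset[OF inj_on_image_edges[OF assms(1,2)]]) auto
  ultimately show ?thesis by (simp add: node_degree_def card_image)
qed

lemma tree_map_graph:
  assumes "tree G" and inj: "inj_on f (nodes G)"
  shows "tree (map_graph f G)"
proof -
  have sg: "simple_graph G" and cg: "connected_graph G" and nc: "\<not> (\<exists>p. is_cycle G p)"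
    using assms by (auto simp: tree_def)
  \<comment> \<open>The inverse pulls a cycle of the image back to a cycle of
    \<open>G\<close>.\<close>
  define g where "g = inv_into (nodes G) f"
  have g: "g (f v) = v" if "v \<in> nodes G" for v using inj that by (simp add: g_def)
  have "simple_graph (map_graph f G)"
    unfolding simple_graph_def
  proof (intro conjI ballI)
    show "finite (nodes (map_graph f G))" using sg by (simp add: simple_graph_def map_graph_def)
    fix e assume "e \<in> edges (map_graph f G)"
    then obtain d where d: "d \<in> edges G" "e = f ` d" by (auto simp: map_graph_def)
    obtain u v where uv: "u \<in> nodes G" "v \<in> nodes G" "u \<noteq> v" "d = {u, v}"
      using sg d(1) unfolding simple_graph_def by blast
    then show "\<exists>u\<in>nodes (map_graph f G). \<exists>v\<in>nodes (map_graph f G). u \<noteq> v \<and> e = {u, v}"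
      using d(2) inj by (intro bexI[of _ "f u"] bexI[of _ "f v"]) (auto simp: map_graph_def inj_on_eq_iff)
  qed
  moreover have "connected_graph (map_graph f G)"
  proof -
    have edge: "{f x, f y} \<in> edges (map_graph f G)" if "{x, y} \<in> edges G" for x y
      using that by (auto simp: map_graph_def intro!: image_eqI[of _ _ "{x, y}"])
    have "(f u, f v) \<in> {(x, y). {x, y} \<in> edges (map_graph f G)}\<^sup>*"
      if "(u, v) \<in> {(x, y). {x, y} \<in> edges G}\<^sup>*" for u v
      using that by (induction rule: rtrancl_induct) (auto intro: rtrancl_into_rtrancl edge)
    then show ?thesis using cg by (auto simp: connected_graph_def map_graph_def)
  qed
  moreover have "\<not> is_cycle (map_graph f G) p" for p
  proof
    assume p: "is_cycle (map_graph f G) p"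
    have edge: "{g x, g y} \<in> edges G \<and> x \<in> f ` nodes G" if xy: "{x, y} \<in> edges (map_graph f G)" for x y
    proof -
      obtain d where d: "d \<in> edges G" "{x, y} = f ` d" using xy by (auto simp: map_graph_def)
      have dn: "d \<subseteq> nodes G" using simple_edge_subset[OF sg d(1)] .
      then have "g ` f ` d = d" using g by force
      then have "{g x, g y} = d" using d(2) by (metis image_empty image_insert)
      then show ?thesis using d dn by blast
    qed
    have len: "3 \<le> length p" and dp: "distinct p"
      and pe: "\<And>i. i < length p \<Longrightarrow> {p ! i, p ! (Suc i mod length p)} \<in> edges (map_graph f G)"
      using p by (auto simp: is_cycle_def)
    have "set p \<subseteq> f ` nodes G" using edge[OF pe] by (auto simp: in_set_conv_nth)
    then have "inj_on g (set p)" unfolding g_def by (rule inj_on_inv_into)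
    then have "distinct (map g p)" using dp by (simp add: distinct_map)
    moreover have "{map g p ! i, map g p ! (Suc i mod length p)} \<in> edges G" if "i < length p" for i
    proof -
      have "Suc i mod length p < length p" using len by (intro mod_less_divisor) linarith
      then show ?thesis using edge[OF pe[OF that]] that by simp
    qed
    ultimately have "is_cycle G (map g p)" using len by (simp add: is_cycle_def)
    then show False using nc by blast
  qed
  ultimately show ?thesis by (simp add: tree_def)
qed

lemma map_graph_full_topology:
  assumes G: "full_steiner_topology n X G" and inj: "inj_on f (nodes G)"
  shows "interconnects (map_graph f G) (f ` X)" "has_topology (f ` X) (map_graph f G) X G"
proof -
  have tree: "tree G" and X: "X \<subseteq> nodes G" and deg: "\<And>s. s \<in> nodes G - X \<Longrightarrow> node_degree G s = 3"
    using G by (auto simp: full_steiner_topology_def)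
  have sg: "simple_graph G" using tree by (simp add: tree_def)
  have "3 \<le> node_degree (map_graph f G) w" if w: "w \<in> nodes (map_graph f G) - f ` X" for w
  proof -
    obtain s where "s \<in> nodes G - X" "w = f s" using w by (auto simp: map_graph_def)
    then show ?thesis using node_degree_map_graph[OF sg inj, of s] deg by simp
  qed
  then show "interconnects (map_graph f G) (f ` X)"
    unfolding interconnects_def using tree_map_graph[OF tree inj] X by (auto simp: map_graph_def)
  show "has_topology (f ` X) (map_graph f G) X G"
    unfolding has_topology_def using inj by (intro exI[of _ f]) (auto simp: map_graph_def bij_betw_def)
qed

text \<open>In the squared norm the linear term gains \<open>2 * c * norm y\<close>, while the
  quadratic term costs at most \<open>c / 4 \<le> c * norm y\<close>, because
  \<open>c * (4 * m)^2 = 1/4\<close>. Half of the gain survives.\<close>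

lemma norm_move_le:
  fixes y z :: point
  assumes "y \<bullet> z = - norm y" "1 \<le> norm y" "norm z \<le> 4 * m" "1 \<le> m" "c = 1 / (64 * m\<^sup>2)"
  shows "norm (y + c *\<^sub>R z) \<le> norm y - c / 2"
proof (rule power2_le_imp_le)
  have m: "1 \<le> m\<^sup>2" using assms(4) by simp
  have c: "0 < c" "c \<le> 1" using m assms(5) frac_le[of 1 1 64 "64 * m\<^sup>2"] by auto
  have "c * (norm z)\<^sup>2 \<le> c * (4 * m)\<^sup>2"
    using c assms(3) by (intro mult_left_mono power_mono) auto
  also have "\<dots> = 1 / 4" using assms(4,5) by (simp add: power2_eq_square field_simps)
  finally have "c * (c * (norm z)\<^sup>2) \<le> c * norm y"
    using c assms(2) by (intro mult_left_mono) linarith+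
  moreover have "(norm (y + c *\<^sub>R z))\<^sup>2 = (norm y)\<^sup>2 - 2 * c * norm y + c * (c * (norm z)\<^sup>2)"
    using assms(1)
    by (simp add: power2_norm_eq_inner inner_add_left inner_add_right inner_commute[of z y] algebra_simps)
  moreover have "(norm y - c / 2)\<^sup>2 = (norm y)\<^sup>2 - c * norm y + (c / 2)\<^sup>2"
    by (simp add: power2_diff)
  moreover have "0 \<le> (c / 2)\<^sup>2" by simp
  ultimately show "(norm (y + c *\<^sub>R z))\<^sup>2 \<le> (norm y - c / 2)\<^sup>2" by linarith
  show "0 \<le> norm y - c / 2" using assms(2) c by simp
qed

lemma ceiling_power_add:
  fixes c :: real
  assumes "0 < c" "c \<le> 1"
  shows "\<lceil>400 ^ j + c\<rceil> = 400 ^ j + 1"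
  by (rule ceiling_unique) (use assms in auto)

section \<open>The extremal example\<close>

theorem proposition7:
  fixes n :: nat and X :: "'a set" and G :: "'a ugraph"
  assumes "full_steiner_topology n X G"
  shows "\<exists>N T_S T_opt. card N = n \<and>
           steiner_minimal_tree N T_S \<and>
           min_steiner_point_tree N T_opt \<and>
           has_topology N T_S X G \<and>
           beads N T_S = beads N T_opt + 2 * int n - 4"
proof -
  obtain r t where r: "r \<in> X" and dt: "distinct_bt t" and rt: "r \<notin> set_bt t"
    and nG: "nodes G = insert r (set_bt t)" and eG: "edges G = insert {r, rt t} (bt_edges t)"
    and lt: "leaves t = X - {r}"
    using full_topology_bt[OF assms] by blast
  have tree: "tree G" and XG: "X \<subseteq> nodes G" and cX: "card X = n" and n2: "2 \<le> n"
    using assms by (auto simp: full_steiner_topology_def)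
  have sg: "simple_graph G" using tree by (simp add: tree_def)
  have finX: "finite X" using XG sg finite_subset by (auto simp: simple_graph_def)
  have e0: "{r, rt t} \<notin> bt_edges t" using rt bt_edges_subset[of "{r, rt t}" t] by auto
  define m where "m = card (edges G)"
  have "card (leaves t) = n - 1" using lt r cX finX by simp
  then have m: "m + 3 = 2 * n" and m1: "m = Suc (card (bt_edges t))"
    using card_bt_edges[OF dt] n2 e0 unfolding m_def eG by auto
  \<comment> \<open>Small enough for \<open>norm_move_le\<close> with relative velocities up to
    \<open>4 * m\<close>, and for moving no node by more than 1/32.\<close>
  define c :: real where "c = 1 / (64 * (real m)\<^sup>2)"
  have m_ge: "1 \<le> real m" using m1 by simp
  then have "1 \<le> (real m)\<^sup>2" by simp
  then have c: "0 < c" "c \<le> 1/64"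
    unfolding c_def using frac_le[of 1 1 64 "64 * (real m)\<^sup>2"] m_ge by auto
  have cm: "c * (2 * real m) \<le> 1/32"
    using m_ge unfolding c_def by (simp add: power2_eq_square field_simps)
  \<comment> \<open>Each length exceeds an integer by \<open>c / 2\<close>, exactly the decrease
    guaranteed by the motion.\<close>
  define R :: "nat \<Rightarrow> real" where "R h = 400 ^ h + c / 2" for h
  interpret scales R
  proof
    have ge: "1 \<le> (400 :: real) ^ h" for h by simp
    show "1 \<le> R h" for h using c ge[of h] unfolding R_def by linarith
    have "200 * (x + c / 2) \<le> 400 * x + c / 2" if "1 \<le> x" for x :: real
      using that c by (simp add: algebra_simps)
    from this[OF ge] show "200 * R h \<le> R (Suc h)" for h by (simp only: R_def power_Suc)
  qed
  define w :: point where "w = axis 1 1"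
  have w: "norm w = 1" by (simp add: w_def)
  define H where "H = height t"
  have H: "height t \<le> H" by (simp add: H_def)
  define q where "q = place t H 0 w"
  obtain v where v0: "\<And>a. a \<in> leaves t \<Longrightarrow> v a = 0"
    and vb: "\<And>b. b \<in> set_bt t \<Longrightarrow> norm (v b) \<le> 2 * real (card (bt_edges t))"
    and ve: "\<And>b d. {b, d} \<in> bt_edges t \<Longrightarrow> (q b - q d) \<bullet> (v b - v d) = - dist (q b) (q d)"
    using velocities[OF dt w, of H 0] unfolding q_def by metis
  \<comment> \<open>The root of \<open>t\<close> sits at the origin, and \<open>r\<close> is put
    behind it so that its edge arrives in direction \<open>w\<close>.\<close>
  define p where "p b = (if b = r then - (R (Suc H) *\<^sub>R w) else q b)" for b
  \<comment> \<open>The motion for time \<open>c\<close>. The leaves have velocity zero and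
    \<open>r\<close> is fixed, so both placements have the same terminals.\<close>
  define p' where "p' b = (if b = r then p r else p b + c *\<^sub>R v b)" for b
  have pq: "p b = q b" "p' b = q b + c *\<^sub>R v b" if "b \<in> set_bt t" for b
    using that rt by (auto simp: p_def p'_def)
  have gap: "200 * R H \<le> R (Suc H)" "1 \<le> R H" using R_gap[of H] R_ge_1[of H] by auto
  have npr: "norm (p r) = R (Suc H)" using w gap by (simp add: p_def)
  have sep_r: "1/2 \<le> dist (p r) (p b)" if "b \<in> set_bt t" for b
    using place_near[OF H w that, of 0] norm_triangle_ineq2[of "p r" "p b"] npr gap pq(1)[OF that]
    by (simp add: dist_norm q_def)
  have sep: "1/2 \<le> dist (p a) (p b)" if "a \<in> nodes G" "b \<in> nodes G" "a \<noteq> b" for a b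
    using that sep_r[of a] sep_r[of b] place_separated[OF H w dt, of a b 0] pq(1) unfolding nG
    by (auto simp: dist_commute q_def)
  have shift: "dist (p' b) (p b) \<le> 1/32" if "b \<in> nodes G" for b
  proof (cases "b = r")
    case False
    then have "norm (v b) \<le> 2 * real m" using vb[of b] that nG m1 by auto
    then have "c * norm (v b) \<le> c * (2 * real m)" using c by (intro mult_left_mono) auto
    then have "c * norm (v b) \<le> 1/32" using cm by linarith
    then show ?thesis using False c(1) by (simp add: p'_def dist_norm)
  qed (simp add: p'_def)
  have injp: "inj_on p (nodes G)"
  proof (intro inj_onI, rule ccontr)
    fix a b assume "a \<in> nodes G" "b \<in> nodes G" "p a = p b" "a \<noteq> b"
    then show False using sep[of a b] by simp
  qed
  \<comment> \<open>Two shifts of at most 1/32 cannot close a gap of 1/2.\<close>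
  have injp': "inj_on p' (nodes G)"
  proof (intro inj_onI, rule ccontr)
    fix a b assume ab: "a \<in> nodes G" "b \<in> nodes G" "p' a = p' b" "a \<noteq> b"
    show False
      using sep[OF ab(1,2,4)] shift[OF ab(1)] shift[OF ab(2)] ab(3)
        dist_triangle[of "p a" "p b" "p' a"] by (simp add: dist_commute)
  qed
  define N where "N = p ` X"
  have p'X: "p' ` X = N" unfolding N_def
  proof (rule image_cong[OF refl])
    fix a assume "a \<in> X"
    then show "p' a = p a" using v0[of a] lt by (cases "a = r") (auto simp: p'_def)
  qed
  have cN: "card N = n" unfolding N_def using card_image[OF inj_on_subset[OF injp XG]] cX by simp
  then have cN2: "2 \<le> card N" using n2 by simp
  let ?S = "map_graph p G" and ?O = "map_graph p' G"
  have S: "interconnects ?S N" "has_topology N ?S X G"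
    using map_graph_full_topology[OF assms injp] by (simp_all add: N_def)
  have O: "interconnects ?O N"
    using map_graph_full_topology(1)[OF assms injp'] p'X by simp
  have p_img: "p ` e = q ` e" if "e \<in> bt_edges t" for e
    using bt_edges_subset[OF that] pq(1) by (intro image_cong) auto
  have p_e0: "diameter (p ` {r, rt t}) = R (Suc H)"
    using npr pq(1)[of "rt t"] by (simp add: diameter_doubleton dist_norm q_def)
  have lenS: "total_length ?S = R (Suc H) + len t H"
    unfolding total_length_def sum_edges_map_graph[OF sg injp]
    using e0 p_e0 sum_place_edges[OF dt w, of H 0] by (simp add: eG p_img q_def)
  \<comment> \<open>A competitor is rooted at the terminal \<open>p r\<close>. It contains all the
    leaves, so \<open>psi_full\<close> applies, and its linear function at \<open>p r\<close> equals
    the length of \<open>?S\<close>.\<close>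
  have lower: "total_length ?S \<le> total_length T" if T: "interconnects T N" for T
  proof -
    have NT: "N \<subseteq> nodes T" using T by (simp add: interconnects_def)
    have "rooted (p r) (nodes T) (edges T)"
      using T NT r by (intro tree_rooted) (auto simp: interconnects_def N_def)
    from rooted_length_ge[OF H w dt this, of 0]
    have "psi t H 0 w {a \<in> leaves t. q a \<in> nodes T} (p r) \<le> total_length T"
      by (simp add: total_length_def q_def)
    moreover have "q a \<in> nodes T" if "a \<in> leaves t" for a
    proof -
      have "p a \<in> N" using that lt by (auto simp: N_def)
      moreover have "p a = q a" using pq(1) leaves_subset[of t] that by blast
      ultimately show ?thesis using NT by auto
    qed
    then have "len t H - w \<bullet> (p r - 0) \<le> psi t H 0 w {a \<in> leaves t. q a \<in> nodes T} (p r)"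
      by (intro psi_full[OF w]) auto
    moreover have "w \<bullet> p r = - R (Suc H)" using w by (simp add: p_def norm_eq_1)
    ultimately show ?thesis using lenS by simp
  qed
  define k where "k e = \<lceil>diameter (p ` e)\<rceil>" for e
  have k: "diameter (p ` e) = R j \<Longrightarrow> real_of_int (k e) = 400 ^ j + 1" for e j
    using ceiling_power_add[of "c / 2" j] c by (simp add: k_def R_def)
  have diam: "\<exists>j. diameter (p ` e) = R j" if "e \<in> edges G" for e
    using that p_e0 place_edge_length[OF dt w, of e H 0] p_img by (auto simp: eG q_def)
  have k_diam: "real_of_int (k e) = diameter (p ` e) - c / 2 + 1" if "e \<in> edges G" for e
    using diam[OF that] k[of e] by (auto simp: R_def)
  \<comment> \<open>A decrease by \<open>c / 2\<close> brings the length from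
    \<open>400 ^ j + c / 2\<close> to at most \<open>400 ^ j\<close>, one below the old
    ceiling.\<close>
  have bt_le: "\<lceil>diameter (p' ` e)\<rceil> \<le> k e - 1" if e: "e \<in> bt_edges t" for e
  proof -
    obtain a b where ab: "a \<noteq> b" "e = {a, b}"
      using sg e unfolding simple_graph_def eG by blast
    have abt: "a \<in> set_bt t" "b \<in> set_bt t" using bt_edges_subset[OF e] ab by auto
    obtain j where j: "dist (q a) (q b) = R j"
      using diam[of e] e eG pq(1) abt ab(2) by (auto simp: diameter_doubleton)
    have "norm (v a - v b) \<le> 4 * real m"
      using norm_triangle_ineq4[of "v a" "v b"] vb[OF abt(1)] vb[OF abt(2)] m1 by simp
    moreover have "(q a - q b) \<bullet> (v a - v b) = - norm (q a - q b)"
      using ve[of a b] e ab(2) by (simp add: dist_norm)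
    moreover have "1 \<le> norm (q a - q b)" using j R_ge_1[of j] by (simp add: dist_norm)
    ultimately have "norm (q a - q b + c *\<^sub>R (v a - v b)) \<le> norm (q a - q b) - c / 2"
      using m_ge c_def by (intro norm_move_le)
    moreover have "p' a - p' b = q a - q b + c *\<^sub>R (v a - v b)"
      using pq(2) abt by (simp add: algebra_simps)
    ultimately have "diameter (p' ` e) \<le> R j - c / 2"
      using j ab(2) by (simp add: diameter_doubleton dist_norm)
    moreover have "real_of_int (k e) = R j - c / 2 + 1"
      using k_diam[of e] e eG j pq(1) abt ab(2) by (simp add: diameter_doubleton)
    ultimately have "diameter (p' ` e) \<le> real_of_int (k e - 1)" by simp
    then show ?thesis unfolding ceiling_le_iff .
  qed
  \<comment> \<open>The edge at \<open>r\<close> may grow, but by at most 1/32, which does not carry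
    it past its old ceiling.\<close>
  have e0_le: "\<lceil>diameter (p' ` {r, rt t})\<rceil> \<le> k {r, rt t}"
  proof -
    have "p' r = p r" by (simp add: p'_def)
    then have "diameter (p' ` {r, rt t}) = dist (p r) (p' (rt t))" by (simp add: diameter_doubleton)
    also have "\<dots> \<le> R (Suc H) + 1/32"
      using dist_triangle[of "p r" "p' (rt t)" "p (rt t)"] shift[of "rt t"] p_e0
      by (simp add: diameter_doubleton dist_commute nG)
    also have "\<dots> \<le> real_of_int (k {r, rt t})" using k[OF p_e0] c by (simp add: R_def)
    finally show ?thesis unfolding ceiling_le_iff .
  qed
  let ?k = "\<Sum>e\<in>edges G. k e"
  have beadsS: "beads N ?S = 1 - int n + ?k"
    using full_splitting_ok(2)[OF S(1) cN2] cN sum_edges_map_graph[OF sg injp] by (simp add: k_def)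
  have bt_sum: "(\<Sum>e\<in>bt_edges t. \<lceil>diameter (p' ` e)\<rceil>) \<le> (\<Sum>e\<in>bt_edges t. k e - 1)"
    by (rule sum_mono) (rule bt_le)
  have "(\<Sum>e\<in>edges G. \<lceil>diameter (p' ` e)\<rceil>) \<le> k {r, rt t} + (\<Sum>e\<in>bt_edges t. k e - 1)"
    unfolding eG using e0 add_mono[OF e0_le bt_sum] by simp
  also have "\<dots> = ?k - int m + 1"
    unfolding eG using e0 m1 by (simp add: sum_subtractf)
  finally have O_le: "beads N ?O \<le> 1 - int n + (?k - int m + 1)"
    unfolding full_splitting_ok(2)[OF O cN2] cN sum_edges_map_graph[OF sg injp'] by simp
  \<comment> \<open>The length of \<open>?S\<close> is \<open>?k - m + m * c / 2\<close>, strictly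
    above \<open>?k - m\<close>. The ceilings of \<open>T\<close> sum to an integer not below that
    length, hence to at least \<open>?k - m + 1\<close>.\<close>
  have beads_ge: "1 - int n + (?k - int m + 1) \<le> beads N T" if T: "interconnects T N" for T
  proof -
    have "real_of_int ?k = (\<Sum>e\<in>edges G. diameter (p ` e) - c / 2 + 1)"
      using k_diam by simp
    also have "\<dots> = total_length ?S - real m * (c / 2) + real m"
      unfolding total_length_def sum_edges_map_graph[OF sg injp]
      by (simp add: sum.distrib sum_subtractf m_def)
    also have "\<dots> < total_length ?S + real m" using c m_ge by simp
    also have "\<dots> \<le> (\<Sum>e\<in>edges T. diameter e) + real m"
      using lower[OF T] by (simp add: total_length_def[of T])
    also have "\<dots> \<le> (\<Sum>e\<in>edges T. real_of_int \<lceil>diameter e\<rceil>) + real m"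
      by (intro add_mono sum_mono) auto
    finally have "real_of_int ?k < real_of_int ((\<Sum>e\<in>edges T. \<lceil>diameter e\<rceil>) + int m)" by simp
    then have "?k < (\<Sum>e\<in>edges T. \<lceil>diameter e\<rceil>) + int m" by (simp only: of_int_less_iff)
    then show ?thesis using full_splitting_ok(2)[OF T cN2] cN by simp
  qed
  show ?thesis
  proof (intro exI conjI)
    show "card N = n" by (rule cN)
    show "steiner_minimal_tree N ?S" using S(1) lower by (simp add: steiner_minimal_tree_def)
    show "min_steiner_point_tree N ?O"
      unfolding min_steiner_point_tree_def using O order_trans[OF O_le beads_ge] by blast
    show "has_topology N ?S X G" by (rule S(2))
    \<comment> \<open>The two counts differ by \<open>m - 1\<close>, where
      \<open>m + 3 = 2 * n\<close>.\<close>
    show "beads N ?S = beads N ?O + 2 * int n - 4"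
      using beadsS O_le beads_ge[OF O] m by linarith
  qed
qed

end
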